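(* Let $K$ be a field, $\overline{K}$ an algebraically closed extension of $K$, $A=K[a_1,\dots,a_m]$, and let $S\subseteq\overline{K}^m$ be a subset defined by a generalized canonical specification (GCS), i.e. by a P-tree with root $r$ that is a GCS of $S$ (so in particular $S=C(r)$). Then: (i) For every vertex $P$ of the P-tree other than the root, $\overline{C(P)}=\mathbb{V}(P)$, where the bar denotes Zariski closure in $\overline{K}^m$. (ii) For the root vertex $r$, $\overline{S}=\overline{C(r)}=\bigcup_{i=1}^d \mathbb{V}(P_i)$, where $P_1,\dots,P_d$ are the children of $r$. (iii) $S$ has a unique GCS decomposition: the P-tree that is a GCS of $S$ is uniquely determined by $S$ (as a rooted tree with nodes labelled by prime ideals, the children of each node being regarded as an unordered set).
   Context: Setting: $K$ is a (computable) field, $\overline{K}$ an algebraically closed extension of $K$, and $A=K[a_1,\dots,a_m]$ is the polynomial ring in the parameters $a_1,\dots,a_m$. For an ideal $J\subseteq A$, $\mathbb{V}(J)\subseteq\overline{K}^m$ is its zero set in $\overline{K}^m$. Zariski closures are taken in $\overline{K}^m$. P-tree: a (finite) rooted directed tree such that (1) all nodes except the root, denoted $r$, are prime ideals of $A$; (2) whenever $P\to Q$ is an arc ($Q$ a child of $P$, $P\neq r$), $P\subsetneq Q$; (3) the children of any node form an irredundant set of prime ideals of $A$ (none contains another), so that they are the irredundant prime decomposition of the radical ideal that is their intersection. The root has level $0$, its children level $1$, and so on. C-tree: to each node of a P-tree one associates a subset of $\overline{K}^m$ recursively: if $P$ is a leaf, $C(P)=\mathbb{V}(P)$; if $P\neq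 r$ is an inner node with children $P_1,\dots,P_d$, $C(P)=\mathbb{V}(P)\setminus(C(P_1)\cup\dots\cup C(P_d))$; if $P_1,\dots,P_d$ are the children of the root $r$, $C(r)=C(P_1)\cup\dots\cup C(P_d)$. Generalized canonical specification (GCS) of a set $S\subseteq\overline{K}^m$: a P-tree with root $r$ such that $S=C(r)$ and such that every node $P$ at level $j\ge 1$ satisfies $C(P)=\mathbb{V}(P)\cap B$, where $B=S$ if $j$ is odd and $B=\overline{K}^m\setminus S$ if $j$ is even. *)

theory Defs
  imports
    "HOL-Library.Poly_Mapping"
    "HOL-Library.FSet"
    "HOL-Computational_Algebra.Polynomial"
    "HOL-Algebra.Ideal"
    "HOL-Algebra.Algebraic_Closure_Type"
begin

section \<open>Polynomials, zero sets and Zariski closure\<close>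

text \<open>
  The parameters are indexed by a finite type 'n (so m is its cardinality), and affine m-space
  over 'l is \<^typ>\<open>'n \<Rightarrow> 'l\<close>. The multiplication on the following type is convolution, that is,
  polynomial multiplication.
\<close>

type_synonym ('k, 'n) mpoly = "('n \<Rightarrow>\<^sub>0 nat) \<Rightarrow>\<^sub>0 'k"

text \<open>
  The field extension is a ring homomorphism \<iota> between two field types (automatically
  injective); polynomials over the small field are evaluated at points over the large one.
\<close>

definition eval_mpoly ::
    "('k::field \<Rightarrow> 'l::field) \<Rightarrow> ('n::finite \<Rightarrow> 'l) \<Rightarrow> ('k, 'n) mpoly \<Rightarrow> 'l" where
  "eval_mpoly \<iota> x f =
     (\<Sum>e\<in>Poly_Mapping.keys f.
        \<iota> (Poly_Mapping.lookup f e) * (\<Prod>i\<in>UNIV. x i ^ Poly_Mapping.lookup e i))"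

definition zero_set ::
    "('k::field \<Rightarrow> 'l::field) \<Rightarrow> ('k, 'n::finite) mpoly set \<Rightarrow> ('n \<Rightarrow> 'l) set" where
  "zero_set \<iota> J = {x. \<forall>f\<in>J. eval_mpoly \<iota> x f = 0}"

text \<open>
  Closed sets are the zero sets of polynomials with coefficients in the large field 'l, not only
  of polynomials over the small one.
\<close>

definition zariski_closed :: "('n::finite \<Rightarrow> 'l::field) set \<Rightarrow> bool" where
  "zariski_closed Z \<longleftrightarrow> (\<exists>F :: ('l, 'n) mpoly set. Z = zero_set id F)"

definition zariski_closure :: "('n::finite \<Rightarrow> 'l::field) set \<Rightarrow> ('n \<Rightarrow> 'l) set" where
  "zariski_closure Y = zariski_closed hull Y"

section \<open>P-trees\<close>

text \<open>
  A vertex other than the root is represented by the subtree hanging below it, since the same ideal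
  may label vertices in different branches. Children form finite sets, so equality of trees
  disregards their order. The root carries no ideal.
\<close>

datatype 'a pnode = PNode (node_ideal: "'a set") (node_children: "'a pnode fset")

datatype 'a ptree = Root (root_children: "'a pnode fset")

inductive vertex_at :: "'a ptree \<Rightarrow> nat \<Rightarrow> 'a pnode \<Rightarrow> bool" for T where
  "N |\<in>| root_children T \<Longrightarrow> vertex_at T 1 N"
| "vertex_at T j N \<Longrightarrow> M |\<in>| node_children N \<Longrightarrow> vertex_at T (Suc j) M"

text \<open>
  In particular, two different children of one vertex never carry the same ideal.
\<close>

definition irredundant :: "'a pnode fset \<Rightarrow> bool" where
  "irredundant Ns \<longleftrightarrow>
     (\<forall>N M. N |\<in>| Ns \<longrightarrow> M |\<in>| Ns \<longrightarrow> N \<noteq> M \<longrightarrow> \<not> node_ideal N \<subseteq> node_ideal M)"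

definition is_ptree :: "('k::field, 'n::finite) mpoly ptree \<Rightarrow> bool" where
  "is_ptree T \<longleftrightarrow>
     (\<forall>j N. vertex_at T j N \<longrightarrow> primeideal (node_ideal N) ring_of_type_algebra) \<and>
     (\<forall>j N M. vertex_at T j N \<longrightarrow> M |\<in>| node_children N \<longrightarrow> node_ideal N \<subset> node_ideal M) \<and>
     irredundant (root_children T) \<and>
     (\<forall>j N. vertex_at T j N \<longrightarrow> irredundant (node_children N))"

section \<open>C-trees and generalized canonical specifications\<close>

text \<open>For a leaf the union is empty, so the equation also covers that case.\<close>

primrec C_node ::
    "('k::field \<Rightarrow> 'l::field) \<Rightarrow> ('k, 'n::finite) mpoly pnode \<Rightarrow> ('n \<Rightarrow> 'l) set" where
  "C_node \<iota> (PNode P Ns) = zero_set \<iota> P - \<Union> (fset (C_node \<iota> |`| Ns))"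

definition C_root ::
    "('k::field \<Rightarrow> 'l::field) \<Rightarrow> ('k, 'n::finite) mpoly ptree \<Rightarrow> ('n \<Rightarrow> 'l) set" where
  "C_root \<iota> T = (\<Union>N\<in>fset (root_children T). C_node \<iota> N)"

definition is_gcs ::
    "('k::field \<Rightarrow> 'l::field) \<Rightarrow> ('k, 'n::finite) mpoly ptree \<Rightarrow> ('n \<Rightarrow> 'l) set \<Rightarrow> bool" where
  "is_gcs \<iota> T S \<longleftrightarrow>
     is_ptree T \<and> S = C_root \<iota> T \<and>
     (\<forall>j N. vertex_at T j N \<longrightarrow>
        C_node \<iota> N = zero_set \<iota> (node_ideal N) \<inter> (if odd j then S else - S))"

end

theory Submission
  imports Defs
begin

text \<open>
  Everything rests on a density statement: if \<open>P\<close> is prime and \<open>f \<notin> P\<close>, then the zeros of \<open>P\<close>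
  at which \<open>f\<close> does not vanish are dense among all zeros of \<open>P\<close>, even for the topology defined by
  polynomials over the large field. Indeed, the extension of \<open>P\<close> to the large field is in general
  no longer prime, but \<open>f\<close> remains a non-zero-divisor modulo it, because the large field has a basis
  over the small one; hence no power of \<open>f g\<close> lies in the extension unless \<open>g\<close> vanishes on the
  zeros of \<open>P\<close>, and the Nullstellensatz applies.

  Density gives the closure of every \<open>C(P)\<close>, as the children of \<open>P\<close> are not contained in \<open>P\<close>.
  Uniqueness follows by descending the tree: the ideal and the level of a node determine \<open>C(P)\<close> by
  the GCS condition, hence the union of the sets of its children, hence the closure of this union,
  whose irredundant decomposition recovers the ideals of the children.
\<close>

section \<open>Extending homomorphisms by one generator\<close>

text \<open>For a subring \<open>R\<close> this is \<open>R[X]\<close>, for an ideal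
  \<open>I\<close> the kernel of reduction modulo \<open>I\<close>. Both stay sets inside
  \<open>'a poly\<close>, so they can be mixed freely.\<close>

definition coeffs_in :: "'a::zero set \<Rightarrow> 'a poly set" where
  "coeffs_in A = {p. \<forall>i. poly.coeff p i \<in> A}"

lemma coeffs_inD: "p \<in> coeffs_in A \<Longrightarrow> poly.coeff p i \<in> A"
  by (simp add: coeffs_in_def)

text \<open>Over a finite field, adding 1 to the product of all \<open>X - a\<close> gives a
  polynomial of positive degree without a root.\<close>

lemma infinite_alg_closed_field: "infinite (UNIV :: 'l::alg_closed_field set)"
proof
  assume fin: "finite (UNIV :: 'l set)"
  define p :: "'l poly" where "p = (\<Prod>a\<in>UNIV. [:- a, 1:])"
  have "Polynomial.degree p = card (UNIV :: 'l set)"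
    unfolding p_def by (subst degree_prod_eq_sum_degree) auto
  then have "Polynomial.degree p > 0" using fin by (simp add: card_gt_0_iff)
  then have "Polynomial.degree (p + 1) > 0" by (simp add: degree_add_eq_left)
  then obtain x where "poly (p + 1) x = 0" using alg_closed_imp_poly_has_root by blast
  moreover have "poly p x = 0" using fin by (auto simp: p_def poly_prod prod_zero_iff)
  ultimately show False by simp
qed

section \<open>Homomorphisms, ideals and subrings in type-class rings\<close>

locale comm_ring_map =
  fixes \<phi> :: "'a::comm_ring_1 \<Rightarrow> 'b::comm_ring_1"
  assumes add: "\<phi> (a + b) = \<phi> a + \<phi> b"
    and mult: "\<phi> (a * b) = \<phi> a * \<phi> b"
    and one [simp]: "\<phi> 1 = 1"
begin

lemma zero [simp]: "\<phi> 0 = 0"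
  using add[of 0 0] by simp

lemma sum: "\<phi> (sum f A) = (\<Sum>x\<in>A. \<phi> (f x))"
  by (induction A rule: infinite_finite_induct) (auto simp: add)

lemma power: "\<phi> (a ^ n) = \<phi> a ^ n"
  by (induction n) (auto simp: mult)

lemma map_poly_add: "map_poly \<phi> (p + q) = map_poly \<phi> p + map_poly \<phi> q"
  by (simp add: poly_eq_iff coeff_map_poly add)

lemma map_poly_smult: "map_poly \<phi> (smult c p) = smult (\<phi> c) (map_poly \<phi> p)"
  by (simp add: poly_eq_iff coeff_map_poly mult)

lemma map_poly_mult: "map_poly \<phi> (p * q) = map_poly \<phi> p * map_poly \<phi> q"
  by (simp add: poly_eq_iff coeff_map_poly coeff_mult mult sum)

lemma poly_map_poly: "poly (map_poly \<phi> p) (\<phi> a) = \<phi> (poly p a)"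
  by (induction p) (auto simp: map_poly_pCons add mult)

end

text \<open>Ideals are sets in a type-class ring, so that the arithmetic of \<open>'a poly\<close>
  and of \<open>mpoly\<close> applies directly; \<open>primeideal_type_prime_ideal\<close> leads
  here from the carrier-based notion.\<close>

locale type_ideal =
  fixes I :: "'a::comm_ring_1 set"
  assumes zero_mem: "0 \<in> I"
    and add_mem: "a \<in> I \<Longrightarrow> b \<in> I \<Longrightarrow> a + b \<in> I"
    and mult_mem: "a \<in> I \<Longrightarrow> r * a \<in> I"
begin

lemma minus_mem: "a \<in> I \<Longrightarrow> - a \<in> I"
  using mult_mem[of a "- 1"] by simp

lemma diff_mem: "a \<in> I \<Longrightarrow> b \<in> I \<Longrightarrow> a - b \<in> I"
  using add_mem[of a "- b"] minus_mem[of b] by simp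

lemma mult_mem_right: "a \<in> I \<Longrightarrow> a * r \<in> I"
  using mult_mem[of a r] by (simp add: mult.commute)

lemma mem_cong: "a - b \<in> I \<Longrightarrow> a \<in> I \<longleftrightarrow> b \<in> I"
  using add_mem[of "a - b" b] diff_mem[of a "a - b"] by auto

lemma sum_mem: "(\<And>x. x \<in> Y \<Longrightarrow> f x \<in> I) \<Longrightarrow> sum f Y \<in> I"
  by (induction Y rule: infinite_finite_induct) (auto intro: zero_mem add_mem)

lemma poly_mem: "p \<in> coeffs_in I \<Longrightarrow> poly p s \<in> I"
  unfolding poly_altdef by (intro sum_mem mult_mem_right coeffs_inD)

lemma coeffs_in_ideal: "type_ideal (coeffs_in I)"
  by unfold_locales
    (auto simp: coeffs_in_def coeff_mult intro!: zero_mem add_mem sum_mem mult_mem)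

end

locale type_prime_ideal = type_ideal +
  assumes one_not_mem: "1 \<notin> I"
    and prime_mem: "a * b \<in> I \<Longrightarrow> a \<in> I \<or> b \<in> I"
begin

lemma mult_mem_iff: "a * b \<in> I \<longleftrightarrow> a \<in> I \<or> b \<in> I"
  using prime_mem mult_mem mult_mem_right by blast

lemma power_mem_iff: "a ^ n \<in> I \<longleftrightarrow> a \<in> I \<and> n > 0"
  by (induction n) (auto simp: mult_mem_iff one_not_mem)

lemma prod_not_mem: "(\<And>x. x \<in> Y \<Longrightarrow> f x \<notin> I) \<Longrightarrow> prod f Y \<notin> I"
  by (induction Y rule: infinite_finite_induct) (auto simp: mult_mem_iff one_not_mem)

end

locale type_subring =
  fixes R :: "'a::comm_ring_1 set"
  assumes zero_in: "0 \<in> R"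
    and one_in: "1 \<in> R"
    and add_in: "a \<in> R \<Longrightarrow> b \<in> R \<Longrightarrow> a + b \<in> R"
    and minus_in: "a \<in> R \<Longrightarrow> - a \<in> R"
    and mult_in: "a \<in> R \<Longrightarrow> b \<in> R \<Longrightarrow> a * b \<in> R"
begin

lemma diff_in: "a \<in> R \<Longrightarrow> b \<in> R \<Longrightarrow> a - b \<in> R"
  using add_in[of a "- b"] minus_in[of b] by simp

lemma sum_in: "(\<And>x. x \<in> Y \<Longrightarrow> f x \<in> R) \<Longrightarrow> sum f Y \<in> R"
  by (induction Y rule: infinite_finite_induct) (auto intro: zero_in add_in)

lemma power_in: "a \<in> R \<Longrightarrow> a ^ n \<in> R"
  by (induction n) (auto intro: one_in mult_in)

lemma coeffs_in_subring: "type_subring (coeffs_in R)"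
  by unfold_locales
    (auto simp: coeffs_in_def coeff_mult coeff_1
      intro!: zero_in one_in add_in minus_in sum_in mult_in)

lemma const_coeffs_in: "a \<in> R \<Longrightarrow> [:a:] \<in> coeffs_in R"
  by (auto simp: coeffs_in_def coeff_pCons zero_in split: nat.split)

lemma smult_coeffs_in: "a \<in> R \<Longrightarrow> p \<in> coeffs_in R \<Longrightarrow> smult a p \<in> coeffs_in R"
  by (auto simp: coeffs_in_def intro: mult_in)

lemma monom_coeffs_in: "a \<in> R \<Longrightarrow> Polynomial.monom a n \<in> coeffs_in R"
  by (auto simp: coeffs_in_def zero_in)

text \<open>Degree bounds are written as vanishing of coefficients, so that the leading coefficient
  \<open>poly.coeff p d\<close> is allowed to be any ring element.\<close>
lemma pseudo_division:
  assumes p: "p \<in> coeffs_in R" "\<And>i. i > d \<Longrightarrow> poly.coeff p i = 0"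
    and w: "w \<in> coeffs_in R"
  shows "\<exists>k y r. y \<in> coeffs_in R \<and> r \<in> coeffs_in R \<and>
    smult (poly.coeff p d ^ k) w = p * y + r \<and> (\<forall>i\<ge>d. poly.coeff r i = 0)"
proof -
  interpret P: type_subring "coeffs_in R" by (rule coeffs_in_subring)
  have "\<exists>k y r. y \<in> coeffs_in R \<and> r \<in> coeffs_in R \<and>
    smult (poly.coeff p d ^ k) w = p * y + r \<and> (\<forall>i\<ge>d. poly.coeff r i = 0)"
    if "w \<in> coeffs_in R" "\<forall>i\<ge>n. poly.coeff w i = 0" for n w
    using that
  proof (induction n arbitrary: w)
    case 0
    then have "w = 0" by (simp add: poly_eq_iff)
    then show ?case by (auto intro!: exI[of _ 0] P.zero_in)
  next
    case (Suc n)
    show ?case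
    proof (cases "n < d")
      case True
      then have "\<forall>i\<ge>d. poly.coeff w i = 0" using Suc.prems by auto
      then show ?thesis
        using Suc.prems by (intro exI[of _ 0] exI[of _ w]) (auto intro: P.zero_in)
    next
      case False
      define c where "c = poly.coeff p d"
      \<comment> \<open>Multiplying \<open>w\<close> by \<open>c\<close> first makes its coefficient
        at \<open>n\<close> equal to that of \<open>p * m\<close>, so nothing in \<open>R\<close>
        has to be divided.\<close>
      define m where "m = Polynomial.monom (poly.coeff w n) (n - d)"
      have m: "m \<in> coeffs_in R"
        unfolding m_def using Suc.prems by (intro monom_coeffs_in coeffs_inD)
      have c: "c \<in> R" using p c_def by (auto intro: coeffs_inD)
      have "\<forall>i\<ge>n. poly.coeff (smult c w - p * m) i = 0"
      proof (intro allI impI)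
        fix i assume "i \<ge> n"
        have "poly.coeff (p * m) i = poly.coeff (m * p) i" by (simp add: mult.commute)
        also have "\<dots> = poly.coeff p (i - (n - d)) * poly.coeff w n"
          using \<open>i \<ge> n\<close> by (simp add: m_def coeff_monom_mult)
        finally have pm: "poly.coeff (p * m) i = poly.coeff p (i - (n - d)) * poly.coeff w n" .
        show "poly.coeff (smult c w - p * m) i = 0"
        proof (cases "i = n")
          case True
          then show ?thesis using False pm by (simp add: c_def)
        next
          case neq: False
          then have "i - (n - d) > d" using \<open>i \<ge> n\<close> False by simp
          then show ?thesis using pm p(2) Suc.prems neq \<open>i \<ge> n\<close> by simp
        qed
      qed
      moreover have "smult c w - p * m \<in> coeffs_in R"
        using Suc.prems p m c by (intro P.diff_in P.mult_in smult_coeffs_in)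
      ultimately obtain k y r where *: "y \<in> coeffs_in R" "r \<in> coeffs_in R"
        "smult (c ^ k) (smult c w - p * m) = p * y + r" "\<forall>i\<ge>d. poly.coeff r i = 0"
        using Suc.IH unfolding c_def by blast
      have "smult (c ^ Suc k) w = p * (y + smult (c ^ k) m) + r"
        using *(3) by (simp add: smult_diff_right algebra_simps)
      moreover have "y + smult (c ^ k) m \<in> coeffs_in R"
        using * m c by (intro P.add_in smult_coeffs_in power_in)
      ultimately show ?thesis using * unfolding c_def by blast
    qed
  qed
  moreover have "\<forall>i\<ge>Suc (Polynomial.degree w). poly.coeff w i = 0"
    by (simp add: coeff_eq_0)
  ultimately show ?thesis using w by blast
qed

end

section \<open>Minimal polynomials modulo a prime ideal\<close>

locale subring_with_prime = type_prime_ideal Q + type_subring R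
  for Q R :: "'a::comm_ring_1 set"
begin

sublocale PQ: type_ideal "coeffs_in Q" by (rule coeffs_in_ideal)
sublocale PR: type_subring "coeffs_in R" by (rule coeffs_in_subring)

text \<open>The degree after reduction modulo \<open>Q\<close>. Coefficients above \<open>n\<close>
  must be 0 and not merely lie in \<open>Q\<close>, because \<open>pseudo_division\<close> by
  \<open>p\<close> requires this.\<close>

definition res_degree :: "'a poly \<Rightarrow> nat \<Rightarrow> bool" where
  "res_degree p n \<longleftrightarrow>
     p \<in> coeffs_in R \<and> (\<forall>i>n. poly.coeff p i = 0) \<and> poly.coeff p n \<notin> Q"

text \<open>Cutting \<open>r\<close> off after its highest coefficient outside \<open>Q\<close>
  removes only coefficients in \<open>Q\<close>.\<close>

lemma res_degree_truncate:
  assumes "r \<in> coeffs_in R" "\<forall>i\<ge>d. poly.coeff r i = 0" "r \<notin> coeffs_in Q"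
  obtains n p where "n < d" "res_degree p n" "r - p \<in> coeffs_in Q"
proof -
  define Y where "Y = {i. poly.coeff r i \<notin> Q}"
  have "Y \<subseteq> {..<d}"
    using assms(2) zero_mem unfolding Y_def by (metis (mono_tags) lessThan_iff mem_Collect_eq not_le subsetI)
  then have fin: "finite Y" using finite_subset by blast
  have ne: "Y \<noteq> {}" using assms(3) by (auto simp: Y_def coeffs_in_def)
  define n where "n = Max Y"
  have n: "n \<in> Y" unfolding n_def using fin ne by (rule Max_in)
  have above: "poly.coeff r i \<in> Q" if "i > n" for i
    using Max_ge[OF fin, of i] that unfolding n_def Y_def by auto
  show thesis
  proof
    show "n < d" using n \<open>Y \<subseteq> _\<close> by auto
    show "res_degree (poly_cutoff (Suc n) r) n"
      using assms(1) n zero_in by (auto simp: res_degree_def coeffs_in_def coeff_poly_cutoff Y_def)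
    show "r - poly_cutoff (Suc n) r \<in> coeffs_in Q"
      using above zero_mem by (auto simp: coeffs_in_def coeff_poly_cutoff)
  qed
qed

text \<open>Otherwise the truncation of \<open>r\<close> would have a residual degree below
  \<open>d\<close> and still vanish at \<open>s\<close> modulo \<open>Q\<close>. This is how
  remainders of pseudo-division by a minimal polynomial are seen to be trivial.\<close>

lemma coeffs_in_below_min_degree:
  assumes "\<forall>n<d. \<forall>p. res_degree p n \<longrightarrow> poly p s \<notin> Q"
    and "r \<in> coeffs_in R" "\<forall>i\<ge>d. poly.coeff r i = 0" "poly r s \<in> Q"
  shows "r \<in> coeffs_in Q"
proof (rule ccontr)
  assume "r \<notin> coeffs_in Q"
  from res_degree_truncate[OF assms(2,3) this] obtain n p
    where np: "n < d" "res_degree p n" "r - p \<in> coeffs_in Q" by blast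
  have "poly r s - poly p s \<in> Q" using poly_mem[OF np(3), of s] by simp
  then show False using mem_cong assms(1,4) np(1,2) by blast
qed

text \<open>Modulo \<open>Q\<close>, the polynomial \<open>p\<close> is a minimal polynomial of \<open>s\<close>, hence prime to every
  polynomial not vanishing at \<open>s\<close>.\<close>
lemma bezout_min_degree:
  assumes min: "\<forall>n<d. \<forall>p. res_degree p n \<longrightarrow> poly p s \<notin> Q"
    and p: "res_degree p d" "poly p s \<in> Q"
    and q: "q \<in> coeffs_in R" "poly q s \<notin> Q"
  obtains e a b where "e \<in> R" "e \<notin> Q" "a \<in> coeffs_in R" "b \<in> coeffs_in R"
    "[:e:] - (a * p + b * q) \<in> coeffs_in Q"
proof -
  \<comment> \<open>\<open>comb w\<close> says that, modulo \<open>Q\<close>, the polynomial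
    \<open>w\<close> lies in the ideal of \<open>R[X]\<close> generated by \<open>p\<close> and
    \<open>q\<close>.\<close>
  define comb where "comb w \<longleftrightarrow> (\<exists>a\<in>coeffs_in R. \<exists>b\<in>coeffs_in R. w - (a * p + b * q) \<in> coeffs_in Q)"
    for w
  have pR: "p \<in> coeffs_in R" using p by (simp add: res_degree_def)
  have comb_p: "comb p" unfolding comb_def
    by (rule bexI[of _ 1], rule bexI[of _ 0]) (auto intro: PR.zero_in PR.one_in PQ.zero_mem)
  have comb_q: "comb q" unfolding comb_def
    by (rule bexI[of _ 0], rule bexI[of _ 1]) (auto intro: PR.zero_in PR.one_in PQ.zero_mem)
  have comb_step: "comb (u - w * y)" if u: "comb u" and w: "comb w" and y: "y \<in> coeffs_in R" for u w y
  proof -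
    from u obtain a b where ab: "a \<in> coeffs_in R" "b \<in> coeffs_in R" "u - (a * p + b * q) \<in> coeffs_in Q"
      unfolding comb_def by blast
    from w obtain a' b' where ab': "a' \<in> coeffs_in R" "b' \<in> coeffs_in R" "w - (a' * p + b' * q) \<in> coeffs_in Q"
      unfolding comb_def by blast
    have "(u - (a * p + b * q)) - (w - (a' * p + b' * q)) * y \<in> coeffs_in Q"
      by (rule PQ.diff_mem[OF ab(3) PQ.mult_mem_right[OF ab'(3)]])
    then have "(u - w * y) - ((a - a' * y) * p + (b - b' * y) * q) \<in> coeffs_in Q"
      by (simp add: algebra_simps)
    then show ?thesis unfolding comb_def
      using ab ab' y by (blast intro: PR.diff_in PR.mult_in)
  qed
  have comb_smult: "comb (smult c u)" if "comb u" "c \<in> R" for c u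
  proof -
    from that obtain a b where ab: "a \<in> coeffs_in R" "b \<in> coeffs_in R" "u - (a * p + b * q) \<in> coeffs_in Q"
      unfolding comb_def by blast
    have "[:c:] * (u - (a * p + b * q)) \<in> coeffs_in Q" using ab by (intro PQ.mult_mem)
    then have "smult c u - (smult c a * p + smult c b * q) \<in> coeffs_in Q"
      by (simp add: algebra_simps smult_diff_right smult_add_right)
    then show ?thesis unfolding comb_def using ab that by (blast intro: smult_coeffs_in)
  qed
  \<comment> \<open>A combination \<open>w\<close> of least residual degree serves as a gcd of
    \<open>p\<close> and \<open>q\<close>; the goal is to show that it is a constant.\<close>
  define e where "e = (LEAST e. \<exists>w. res_degree w e \<and> comb w)"
  have "\<exists>e w. res_degree w e \<and> comb w" using p comb_p by blast
  then have "\<exists>w. res_degree w e \<and> comb w" unfolding e_def by (rule LeastI_ex)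
  then obtain w where w: "res_degree w e" "comb w" by blast
  have wmin: "\<not> (res_degree v n \<and> comb v)" if "n < e" for n v
    using not_less_Least[of n "\<lambda>e. \<exists>w. res_degree w e \<and> comb w"] that unfolding e_def by blast
  have wR: "w \<in> coeffs_in R" and we: "\<And>i. i > e \<Longrightarrow> poly.coeff w i = 0"
    and wl: "poly.coeff w e \<notin> Q" using w by (auto simp: res_degree_def)
  define c where "c = poly.coeff w e"
  have cR: "c \<in> R" using wR by (auto simp: c_def intro: coeffs_inD)
  \<comment> \<open>The pseudo-remainder is again a combination, so by minimality of
    \<open>e\<close> it vanishes modulo \<open>Q\<close>.\<close>
  have divides: "\<exists>k. \<exists>y\<in>coeffs_in R. smult (c ^ k) u - w * y \<in> coeffs_in Q"
    if u: "comb u" "u \<in> coeffs_in R" for u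
  proof -
    obtain k y r where kyr: "y \<in> coeffs_in R" "r \<in> coeffs_in R"
      "smult (c ^ k) u = w * y + r" "\<forall>i\<ge>e. poly.coeff r i = 0"
      using pseudo_division[OF wR we u(2)] unfolding c_def by blast
    have r: "r = smult (c ^ k) u - w * y" using kyr by simp
    have cr: "comb r" unfolding r
      using u w kyr cR by (intro comb_step comb_smult power_in)
    have "r \<in> coeffs_in Q"
    proof (rule ccontr)
      assume "r \<notin> coeffs_in Q"
      from res_degree_truncate[OF kyr(2,4) this] obtain n v
        where nv: "n < e" "res_degree v n" "r - v \<in> coeffs_in Q" by blast
      from cr obtain a b where ab: "a \<in> coeffs_in R" "b \<in> coeffs_in R" "r - (a * p + b * q) \<in> coeffs_in Q"
        unfolding comb_def by blast
      have "(r - (a * p + b * q)) - (r - v) \<in> coeffs_in Q" by (rule PQ.diff_mem[OF ab(3) nv(3)])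
      then have "comb v" unfolding comb_def using ab by (auto simp: algebra_simps)
      then show False using wmin nv by blast
    qed
    then show ?thesis using kyr r by blast
  qed
  have cQ: "c ^ k \<notin> Q" for k using wl by (simp add: power_mem_iff c_def)
  \<comment> \<open>\<open>w\<close> divides a multiple of \<open>q\<close> modulo \<open>Q\<close>,
    so it cannot vanish at \<open>s\<close>. It also divides a multiple of \<open>p\<close>, which
    does vanish there; hence the cofactor of \<open>p\<close> vanishes at \<open>s\<close>.\<close>
  have "poly w s \<notin> Q"
  proof
    assume ws: "poly w s \<in> Q"
    obtain k y where "smult (c ^ k) q - w * y \<in> coeffs_in Q" using divides[OF comb_q q(1)] by blast
    from poly_mem[OF this, of s] have "c ^ k * poly q s - poly w s * poly y s \<in> Q" by simp
    then have "c ^ k * poly q s \<in> Q" using mem_cong mult_mem_right[OF ws] by blast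
    then show False using cQ q by (auto simp: mult_mem_iff)
  qed
  obtain k y where y: "y \<in> coeffs_in R" "smult (c ^ k) p - w * y \<in> coeffs_in Q"
    using divides[OF comb_p pR] by blast
  from poly_mem[OF y(2), of s] have "c ^ k * poly p s - poly w s * poly y s \<in> Q" by simp
  then have "poly w s * poly y s \<in> Q" using mem_cong mult_mem[OF p(2)] by blast
  then have ys: "poly y s \<in> Q" using \<open>poly w s \<notin> Q\<close> by (auto simp: mult_mem_iff)
  \<comment> \<open>The cofactor \<open>y\<close> vanishes at \<open>s\<close>, so its residual
    degree \<open>n\<close> is at least \<open>d\<close>. For positive \<open>e\<close> the product
    \<open>w * v\<close> then has a coefficient outside \<open>Q\<close> at \<open>e + n\<close>,
    where \<open>p\<close> has none.\<close>
  have "e = 0"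
  proof (rule ccontr)
    assume "e \<noteq> 0"
    have "y \<notin> coeffs_in Q"
    proof
      assume "y \<in> coeffs_in Q"
      then have "w * y \<in> coeffs_in Q" by (rule PQ.mult_mem)
      then have "smult (c ^ k) p \<in> coeffs_in Q" using PQ.mem_cong[OF y(2)] by blast
      from coeffs_inD[OF this, of d] show False
        using cQ p by (auto simp: mult_mem_iff res_degree_def)
    qed
    moreover have "\<forall>i\<ge>Suc (Polynomial.degree y). poly.coeff y i = 0" by (simp add: coeff_eq_0)
    ultimately obtain n v where nv: "res_degree v n" "y - v \<in> coeffs_in Q"
      using res_degree_truncate[OF y(1)] by metis
    have "poly y s - poly v s \<in> Q" using poly_mem[OF nv(2), of s] by simp
    then have "poly v s \<in> Q" using ys mem_cong by blast
    then have "n \<ge> d" using min nv(1) by (meson not_le)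
    have "(smult (c ^ k) p - w * y) + w * (y - v) \<in> coeffs_in Q"
      by (rule PQ.add_mem[OF y(2) PQ.mult_mem[OF nv(2)]])
    then have "smult (c ^ k) p - w * v \<in> coeffs_in Q" by (simp add: algebra_simps)
    from coeffs_inD[OF this, of "e + n"]
    have "c ^ k * poly.coeff p (e + n) - poly.coeff (w * v) (e + n) \<in> Q" by simp
    moreover have "poly.coeff p (e + n) = 0"
      using p \<open>n \<ge> d\<close> \<open>e \<noteq> 0\<close> by (simp add: res_degree_def)
    moreover have "poly.coeff (w * v) (e + n) = c * poly.coeff v n"
    proof -
      have *: "poly.coeff w i * poly.coeff v (e + n - i) = 0" if "i \<le> e + n" "i \<noteq> e" for i
      proof (cases "i > e")
        case False
        then have "e + n - i > n" using that by simp
        then show ?thesis using nv by (simp add: res_degree_def)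
      qed (use we in simp)
      have "poly.coeff (w * v) (e + n) = (\<Sum>i\<le>e + n. poly.coeff w i * poly.coeff v (e + n - i))"
        by (simp add: coeff_mult)
      also have "\<dots> = (\<Sum>i\<in>{e}. poly.coeff w i * poly.coeff v (e + n - i))"
        using * by (intro sum.mono_neutral_right) auto
      finally show ?thesis by (simp add: c_def)
    qed
    ultimately have "c * poly.coeff v n \<in> Q" using minus_mem by fastforce
    then show False using wl nv by (auto simp: mult_mem_iff c_def res_degree_def)
  qed
  then have w_const: "w = [:c:]" using we by (auto simp: poly_eq_iff coeff_pCons c_def split: nat.split)
  from w(2) obtain a b where ab: "a \<in> coeffs_in R" "b \<in> coeffs_in R" "w - (a * p + b * q) \<in> coeffs_in Q"
    unfolding comb_def by blast
  show thesis
  proof (rule that[OF cR _ ab(1,2)])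
    show "c \<notin> Q" using wl by (simp add: c_def)
    show "[:c:] - (a * p + b * q) \<in> coeffs_in Q" using ab(3) by (simp add: w_const)
  qed
qed


text \<open>Evaluating \<open>map_poly \<phi> w\<close> at \<open>\<xi>\<close> is the extension of \<open>\<phi>\<close> to \<open>R[s] / (Q \<inter> R[s])\<close> with
  \<open>s \<mapsto> \<xi>\<close>.\<close>
lemma hom_extension:
  assumes q: "q \<in> coeffs_in R" "poly q s \<notin> Q"
  obtains u where "u \<in> R" "u \<notin> Q"
    "\<And>\<phi> :: 'a \<Rightarrow> 'l::alg_closed_field. \<lbrakk>comm_ring_map \<phi>; \<And>a. a \<in> R \<Longrightarrow> a \<in> Q \<Longrightarrow> \<phi> a = 0; \<phi> u \<noteq> 0\<rbrakk> \<Longrightarrow>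
      \<exists>\<xi>. (\<forall>w\<in>coeffs_in R. poly w s \<in> Q \<longrightarrow> poly (map_poly \<phi> w) \<xi> = 0) \<and>
        poly (map_poly \<phi> q) \<xi> \<noteq> 0"
proof (cases "\<exists>n p. res_degree p n \<and> poly p s \<in> Q")
  case False
  \<comment> \<open>Here \<open>s\<close> is transcendental modulo \<open>Q\<close>: every
    \<open>\<xi>\<close> respects the relations, and only the roots of the image of \<open>q\<close>
    must be avoided. A coefficient of \<open>q\<close> outside \<open>Q\<close> serves as
    \<open>u\<close> and keeps this image nonzero.\<close>
  have zero: "w \<in> coeffs_in Q" if "w \<in> coeffs_in R" "poly w s \<in> Q" for w
    by (rule coeffs_in_below_min_degree[of "Suc (Polynomial.degree w)" s])
      (use False that in \<open>auto intro: coeff_eq_0\<close>)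
  have "q \<notin> coeffs_in Q" using q poly_mem by blast
  then obtain i where i: "poly.coeff q i \<notin> Q" by (auto simp: coeffs_in_def)
  show thesis
  proof (rule that[of "poly.coeff q i"])
    show "poly.coeff q i \<in> R" "poly.coeff q i \<notin> Q" using q i by (auto intro: coeffs_inD)
  next
    fix \<phi> :: "'a \<Rightarrow> 'l" assume \<phi>: "comm_ring_map \<phi>" and kill: "\<And>a. a \<in> R \<Longrightarrow> a \<in> Q \<Longrightarrow> \<phi> a = 0"
      and nz: "\<phi> (poly.coeff q i) \<noteq> 0"
    interpret \<phi>: comm_ring_map \<phi> by (rule \<phi>)
    have "poly.coeff (map_poly \<phi> q) i \<noteq> 0" using nz by (simp add: coeff_map_poly)
    then have "map_poly \<phi> q \<noteq> 0" by fastforce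
    then have "finite {x. poly (map_poly \<phi> q) x = 0}" by (rule poly_roots_finite)
    then obtain \<xi> where "poly (map_poly \<phi> q) \<xi> \<noteq> 0"
      using infinite_alg_closed_field ex_new_if_finite by blast
    moreover have "map_poly \<phi> w = 0" if "w \<in> coeffs_in R" "poly w s \<in> Q" for w
      using zero[OF that] that(1) kill by (auto simp: poly_eq_iff coeff_map_poly intro: coeffs_inD)
    ultimately show "\<exists>\<xi>. (\<forall>w\<in>coeffs_in R. poly w s \<in> Q \<longrightarrow> poly (map_poly \<phi> w) \<xi> = 0) \<and>
        poly (map_poly \<phi> q) \<xi> \<noteq> 0" by (intro exI[of _ \<xi>]) auto
  qed
next
  case True
  \<comment> \<open>Here \<open>s\<close> is algebraic modulo \<open>Q\<close>, and
    \<open>\<xi>\<close> must be a root of the image of a minimal polynomial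
    \<open>p\<close>.\<close>
  define d where "d = (LEAST n. \<exists>p. res_degree p n \<and> poly p s \<in> Q)"
  have "\<exists>p. res_degree p d \<and> poly p s \<in> Q" unfolding d_def using True by (rule LeastI_ex)
  then obtain p where p: "res_degree p d" "poly p s \<in> Q" by blast
  have min: "\<forall>n<d. \<forall>p. res_degree p n \<longrightarrow> poly p s \<notin> Q"
    unfolding d_def using not_less_Least[of _ "\<lambda>n. \<exists>p. res_degree p n \<and> poly p s \<in> Q"] by blast
  obtain e a b where eab: "e \<in> R" "e \<notin> Q" "a \<in> coeffs_in R" "b \<in> coeffs_in R"
    "[:e:] - (a * p + b * q) \<in> coeffs_in Q"
    using bezout_min_degree[OF min p q] by blast
  define c where "c = poly.coeff p d"
  have pR: "p \<in> coeffs_in R" and pd: "\<And>i. i > d \<Longrightarrow> poly.coeff p i = 0" and cQ: "c \<notin> Q"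
    using p by (auto simp: res_degree_def c_def)
  have cR: "c \<in> R" using pR by (auto simp: c_def intro: coeffs_inD)
  have "d \<noteq> 0"
  proof
    assume "d = 0"
    then have "p = [:c:]" using pd by (auto simp: poly_eq_iff coeff_pCons c_def split: nat.split)
    then show False using p cQ by simp
  qed
  \<comment> \<open>If \<open>\<phi>\<close> does not kill \<open>c\<close>, the image of
    \<open>p\<close> has positive degree and powers of \<open>c\<close> can be cancelled; if it does
    not kill \<open>e\<close>, the Bezout relation keeps \<open>q\<close> nonzero at the chosen
    root.\<close>
  show thesis
  proof (rule that[of "c * e"])
    show "c * e \<in> R" "c * e \<notin> Q" using cR cQ eab by (auto simp: mult_mem_iff intro: mult_in)
  next
    fix \<phi> :: "'a \<Rightarrow> 'l" assume \<phi>: "comm_ring_map \<phi>" and kill: "\<And>a. a \<in> R \<Longrightarrow> a \<in> Q \<Longrightarrow> \<phi> a = 0"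
      and nz: "\<phi> (c * e) \<noteq> 0"
    interpret \<phi>: comm_ring_map \<phi> by (rule \<phi>)
    have c0: "\<phi> c \<noteq> 0" and e0: "\<phi> e \<noteq> 0" using nz by (auto simp: \<phi>.mult)
    have killp: "map_poly \<phi> w = 0" if "w \<in> coeffs_in R" "w \<in> coeffs_in Q" for w
      using that kill by (auto simp: poly_eq_iff coeff_map_poly intro: coeffs_inD)
    have "poly.coeff (map_poly \<phi> p) d \<noteq> 0" using c0 by (simp add: coeff_map_poly c_def)
    then have "Polynomial.degree (map_poly \<phi> p) > 0" using \<open>d \<noteq> 0\<close> le_degree by fastforce
    then obtain \<xi> where \<xi>: "poly (map_poly \<phi> p) \<xi> = 0" using alg_closed_imp_poly_has_root by blast
    have "poly (map_poly \<phi> w) \<xi> = 0" if w: "w \<in> coeffs_in R" "poly w s \<in> Q" for w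
    proof -
      obtain k y r where kyr: "y \<in> coeffs_in R" "r \<in> coeffs_in R"
        "smult (c ^ k) w = p * y + r" "\<forall>i\<ge>d. poly.coeff r i = 0"
        using pseudo_division[OF pR pd w(1)] unfolding c_def by blast
      have "r = smult (c ^ k) w - p * y" using kyr(3) by simp
      then have "poly r s = c ^ k * poly w s - poly p s * poly y s" by simp
      then have "poly r s \<in> Q" using w p by (auto intro: diff_mem mult_mem mult_mem_right)
      then have "r \<in> coeffs_in Q" using coeffs_in_below_min_degree[OF min kyr(2,4)] by blast
      then have "map_poly \<phi> (smult (c ^ k) w) = map_poly \<phi> p * map_poly \<phi> y"
        unfolding kyr(3) using killp kyr by (simp add: \<phi>.map_poly_add \<phi>.map_poly_mult)
      then have "poly (map_poly \<phi> (smult (c ^ k) w)) \<xi> = 0" using \<xi> by simp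
      then show ?thesis using c0 by (simp add: \<phi>.map_poly_smult \<phi>.power)
    qed
    moreover have "poly (map_poly \<phi> q) \<xi> \<noteq> 0"
    proof
      assume *: "poly (map_poly \<phi> q) \<xi> = 0"
      define z where "z = [:e:] - (a * p + b * q)"
      have "z \<in> coeffs_in R" unfolding z_def using eab pR q
        by (intro PR.diff_in PR.add_in PR.mult_in const_coeffs_in)
      then have "map_poly \<phi> z = 0" using killp eab(5) unfolding z_def by blast
      moreover have "[:e:] = z + (a * p + b * q)" by (simp add: z_def)
      ultimately have "map_poly \<phi> [:e:] = map_poly \<phi> a * map_poly \<phi> p + map_poly \<phi> b * map_poly \<phi> q"
        by (simp only: \<phi>.map_poly_add \<phi>.map_poly_mult add_0_left)
      then have "poly (map_poly \<phi> [:e:]) \<xi> = 0" using \<xi> * by simp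
      then show False using e0 by (simp add: map_poly_pCons)
    qed
    ultimately show "\<exists>\<xi>. (\<forall>w\<in>coeffs_in R. poly w s \<in> Q \<longrightarrow> poly (map_poly \<phi> w) \<xi> = 0) \<and>
        poly (map_poly \<phi> q) \<xi> \<noteq> 0" by blast
  qed
qed

end

section \<open>The Nullstellensatz\<close>

text \<open>By Zorn's lemma there is an ideal maximal among those that contain \<open>I\<close> and
  miss all powers of \<open>h\<close>; such an ideal is prime.\<close>

lemma exists_prime_ideal_avoiding_powers:
  assumes "type_ideal I" and h: "\<And>n. h ^ n \<notin> I"
  obtains Q where "type_prime_ideal Q" "I \<subseteq> Q" "h \<notin> Q"
proof -
  define \<A> where "\<A> = {J. type_ideal J \<and> I \<subseteq> J \<and> (\<forall>n. h ^ n \<notin> J)}"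
  have "\<exists>Q\<in>\<A>. \<forall>J\<in>\<A>. Q \<subseteq> J \<longrightarrow> J = Q"
  proof (rule subset_Zorn_nonempty)
    show "\<A> \<noteq> {}" using assms by (auto simp: \<A>_def)
  next
    fix \<C> assume C: "\<C> \<noteq> {}" "subset.chain \<A> \<C>"
    have sub: "\<C> \<subseteq> \<A>" using C by (simp add: subset.chain_def)
    have comp: "J \<subseteq> J' \<or> J' \<subseteq> J" if "J \<in> \<C>" "J' \<in> \<C>" for J J'
      using C that by (auto simp: subset_chain_def)
    have "type_ideal (\<Union>\<C>)"
    proof
      from C(1) obtain J where "J \<in> \<C>" by blast
      then show "0 \<in> \<Union>\<C>" using sub by (auto simp: \<A>_def intro: type_ideal.zero_mem)
    next
      fix a b assume "a \<in> \<Union>\<C>" "b \<in> \<Union>\<C>"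
      then obtain J where "J \<in> \<C>" "a \<in> J" "b \<in> J" using comp by blast
      then show "a + b \<in> \<Union>\<C>" using sub unfolding \<A>_def by (blast intro: type_ideal.add_mem)
    next
      fix a r assume "a \<in> \<Union>\<C>"
      then show "r * a \<in> \<Union>\<C>" using sub unfolding \<A>_def by (blast intro: type_ideal.mult_mem)
    qed
    then show "\<Union>\<C> \<in> \<A>" using C sub by (auto simp: \<A>_def)
  qed
  then obtain Q where Q: "Q \<in> \<A>" and max: "\<And>J. J \<in> \<A> \<Longrightarrow> Q \<subseteq> J \<Longrightarrow> J = Q" by blast
  interpret Q: type_ideal Q using Q by (simp add: \<A>_def)
  \<comment> \<open>By maximality, the ideal generated by \<open>Q\<close> and \<open>a\<close> must
    contain a power of \<open>h\<close>.\<close>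
  have hits: "\<exists>n q r. q \<in> Q \<and> h ^ n = q + r * a" if "a \<notin> Q" for a
  proof (rule ccontr)
    assume none: "\<not> (\<exists>n q r. q \<in> Q \<and> h ^ n = q + r * a)"
    define J where "J = {q + r * a | q r. q \<in> Q}"
    have "type_ideal J"
    proof
      show "0 \<in> J" unfolding J_def using Q.zero_mem by (auto intro!: exI[of _ 0])
    next
      fix u v assume "u \<in> J" "v \<in> J"
      then obtain q r q' r' where u: "u = q + r * a" and v: "v = q' + r' * a" and q: "q \<in> Q" "q' \<in> Q"
        unfolding J_def by blast
      have "u + v = (q + q') + (r + r') * a" unfolding u v by (simp add: algebra_simps)
      moreover have "q + q' \<in> Q" using q by (rule Q.add_mem)
      ultimately show "u + v \<in> J" unfolding J_def by blast
    next
      fix u s assume "u \<in> J"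
      then obtain q r where u: "u = q + r * a" and q: "q \<in> Q" unfolding J_def by blast
      have "s * u = s * q + (s * r) * a" unfolding u by (simp add: algebra_simps)
      moreover have "s * q \<in> Q" using q by (rule Q.mult_mem)
      ultimately show "s * u \<in> J" unfolding J_def by blast
    qed
    moreover have "Q \<subseteq> J" unfolding J_def by (force intro: exI[of _ 0])
    moreover have "h ^ n \<notin> J" for n using none unfolding J_def by blast
    ultimately have "J = Q" using Q by (intro max) (auto simp: \<A>_def)
    moreover have "a \<in> J" unfolding J_def using Q.zero_mem by (force intro: exI[of _ 1])
    ultimately show False using that by blast
  qed
  have "type_prime_ideal Q"
  proof
    show "1 \<notin> Q" using Q unfolding \<A>_def by (metis (mono_tags, lifting) mem_Collect_eq power_0)
  next
    fix a b assume ab: "a * b \<in> Q"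
    show "a \<in> Q \<or> b \<in> Q"
    proof (rule ccontr)
      assume "\<not> (a \<in> Q \<or> b \<in> Q)"
      then obtain m n q r q' r' where *: "q \<in> Q" "h ^ m = q + r * a" "q' \<in> Q" "h ^ n = q' + r' * b"
        using hits by metis
      \<comment> \<open>The product of the two powers lies in the ideal generated by
        \<open>Q\<close> and \<open>a * b\<close>, which is \<open>Q\<close> itself.\<close>
      have "h ^ (m + n) = q * (q' + r' * b) + r * a * q' + (r * r') * (a * b)"
        unfolding power_add *(2,4) by (simp add: algebra_simps)
      then have "h ^ (m + n) \<in> Q"
        using Q.add_mem[OF Q.add_mem[OF Q.mult_mem_right[OF *(1)] Q.mult_mem[OF *(3)]] Q.mult_mem[OF ab]]
        by simp
      then show False using Q by (auto simp: \<A>_def)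
    qed
  qed
  moreover have "h \<notin> Q"
    using Q unfolding \<A>_def by (metis (mono_tags, lifting) mem_Collect_eq power_one_right)
  ultimately show thesis using Q that by (auto simp: \<A>_def)
qed

section \<open>Evaluation of multivariate polynomials\<close>

lemma sum_single_lookup:
  fixes f :: "'a \<Rightarrow>\<^sub>0 'b::comm_monoid_add"
  shows "(\<Sum>e\<in>Poly_Mapping.keys f. Poly_Mapping.single e (Poly_Mapping.lookup f e)) = f"
  by (rule poly_mapping_eqI)
    (auto simp: lookup_sum lookup_single when_def in_keys_iff sum.delta)

text \<open>The index set of the defining sum depends on the polynomial; a common larger one allows
  evaluations of different polynomials to be compared.\<close>

lemma eval_mpoly_superset:
  assumes "\<iota> 0 = 0" "finite E" "Poly_Mapping.keys f \<subseteq> E"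
  shows "eval_mpoly \<iota> x f =
    (\<Sum>e\<in>E. \<iota> (Poly_Mapping.lookup f e) * (\<Prod>i\<in>UNIV. x i ^ Poly_Mapping.lookup e i))"
  unfolding eval_mpoly_def using assms
  by (intro sum.mono_neutral_left) (auto simp: in_keys_iff)

lemma eval_mpoly_single:
  assumes "\<iota> 0 = 0"
  shows "eval_mpoly \<iota> x (Poly_Mapping.single e c) = \<iota> c * (\<Prod>i\<in>UNIV. x i ^ Poly_Mapping.lookup e i)"
  by (subst eval_mpoly_superset[where E = "{e}"]) (auto simp: assms)

lemma eval_mpoly_add:
  assumes "\<iota> 0 = 0" "\<And>a b. \<iota> (a + b) = \<iota> a + \<iota> b"
  shows "eval_mpoly \<iota> x (f + g) = eval_mpoly \<iota> x f + eval_mpoly \<iota> x g"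
proof -
  let ?E = "Poly_Mapping.keys f \<union> Poly_Mapping.keys g"
  have "Poly_Mapping.keys (f + g) \<subseteq> ?E" by (rule Poly_Mapping.keys_add)
  then show ?thesis using assms
    by (simp add: eval_mpoly_superset[of \<iota> ?E] lookup_add algebra_simps sum.distrib)
qed

lemma eval_mpoly_hom:
  assumes "comm_ring_map \<iota>"
  shows "comm_ring_map (eval_mpoly \<iota> x :: ('k::field, 'n::finite) mpoly \<Rightarrow> 'l::field)"
proof -
  interpret \<iota>: comm_ring_map \<iota> by (rule assms)
  have add: "eval_mpoly \<iota> x (f + g) = eval_mpoly \<iota> x f + eval_mpoly \<iota> x g" for f g
    by (simp add: eval_mpoly_add \<iota>.add)
  have [simp]: "eval_mpoly \<iota> x 0 = 0" by (simp add: eval_mpoly_def)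
  have sum: "eval_mpoly \<iota> x (sum F A) = (\<Sum>a\<in>A. eval_mpoly \<iota> x (F a))" for F and A :: "'z set"
    by (induction A rule: infinite_finite_induct) (auto simp: add)
  have single: "eval_mpoly \<iota> x (Poly_Mapping.single e c * Poly_Mapping.single e' c') =
      eval_mpoly \<iota> x (Poly_Mapping.single e c) * eval_mpoly \<iota> x (Poly_Mapping.single e' c')" for e c e' c'
    by (simp add: mult_single eval_mpoly_single lookup_add power_add prod.distrib \<iota>.mult)
  show ?thesis
  proof
    fix f g :: "('k, 'n) mpoly"
    let ?f = "\<lambda>e. Poly_Mapping.single e (Poly_Mapping.lookup f e)"
    let ?g = "\<lambda>e. Poly_Mapping.single e (Poly_Mapping.lookup g e)"
    have "eval_mpoly \<iota> x (sum ?f (Poly_Mapping.keys f) * sum ?g (Poly_Mapping.keys g)) =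
      eval_mpoly \<iota> x (sum ?f (Poly_Mapping.keys f)) * eval_mpoly \<iota> x (sum ?g (Poly_Mapping.keys g))"
      by (simp add: sum_product sum single)
    then show "eval_mpoly \<iota> x (f * g) = eval_mpoly \<iota> x f * eval_mpoly \<iota> x g"
      by (simp only: sum_single_lookup)
  next
    show "eval_mpoly \<iota> x 1 = 1"
      using eval_mpoly_single[of \<iota> x 0 1, OF \<iota>.zero] by simp
  qed (rule add)
qed

section \<open>Polynomials in some of the variables\<close>

definition mvar :: "'n::finite \<Rightarrow> ('l::field, 'n) mpoly" where
  "mvar i = Poly_Mapping.single (Poly_Mapping.single i 1) 1"

text \<open>Iterated univariate polynomials, realised as subrings of one fixed type, so that an
  induction on the variables does not change the type.\<close>

fun polys_in :: "'n::finite list \<Rightarrow> ('l::field, 'n) mpoly set" where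
  "polys_in [] = range (Poly_Mapping.single 0)"
| "polys_in (i # vs) = (\<lambda>w. poly w (mvar i)) ` coeffs_in (polys_in vs)"

lemma polys_in_subring: "type_subring (polys_in vs :: ('l::field, 'n::finite) mpoly set)"
proof (induction vs)
  case Nil
  have "0 \<in> range (Poly_Mapping.single 0)" "1 \<in> range (Poly_Mapping.single 0)"
    by (metis rangeI single_zero, metis rangeI single_one)
  then show ?case
    by unfold_locales
      (auto simp: single_add[symmetric] single_uminus[symmetric] mult_single)
next
  case (Cons i vs)
  interpret type_subring "polys_in vs :: ('l, 'n) mpoly set" by (rule Cons)
  interpret P: type_subring "coeffs_in (polys_in vs :: ('l, 'n) mpoly set)" by (rule coeffs_in_subring)
  show ?case
  proof
    show "0 \<in> (polys_in (i # vs) :: ('l, 'n) mpoly set)" using P.zero_in by (auto intro!: image_eqI[of _ _ 0])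
    show "1 \<in> (polys_in (i # vs) :: ('l, 'n) mpoly set)" using P.one_in by (auto intro!: image_eqI[of _ _ 1])
  next
    fix a b :: "('l, 'n) mpoly" assume "a \<in> polys_in (i # vs)" "b \<in> polys_in (i # vs)"
    then obtain v w where "a = poly v (mvar i)" "b = poly w (mvar i)"
      "v \<in> coeffs_in (polys_in vs)" "w \<in> coeffs_in (polys_in vs)" by auto
    then show "a + b \<in> polys_in (i # vs)" "a * b \<in> polys_in (i # vs)" "- a \<in> polys_in (i # vs)"
      using P.add_in[of v w] P.mult_in[of v w] P.minus_in[of v]
      by (auto simp flip: poly_add poly_mult poly_minus)
  qed
qed

lemma polys_in_Cons_mono: "polys_in vs \<subseteq> polys_in (i # vs)"
  using type_subring.const_coeffs_in[OF polys_in_subring] by (auto intro!: image_eqI[of _ _ "[:_:]"])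

lemma const_polys_in: "Poly_Mapping.single 0 c \<in> polys_in vs"
proof (induction vs)
  case (Cons i vs)
  then show ?case using polys_in_Cons_mono by blast
qed simp

lemma mvar_polys_in: "i \<in> set vs \<Longrightarrow> mvar i \<in> polys_in vs"
proof (induction vs)
  case (Cons j vs)
  interpret type_subring "polys_in vs" by (rule polys_in_subring)
  have "[:0, 1:] \<in> coeffs_in (polys_in vs)"
    by (auto simp: coeffs_in_def coeff_pCons zero_in one_in split: nat.split)
  then have "mvar j \<in> polys_in (j # vs)" by (auto intro!: image_eqI[of _ _ "[:0, 1:]"])
  then show ?case using Cons polys_in_Cons_mono by auto
qed simp

lemma mvar_power: "mvar i ^ n = Poly_Mapping.single (Poly_Mapping.single i n) 1"
  by (induction n) (auto simp: mvar_def mult_single simp flip: single_add)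

lemma prod_single_one:
  "(\<Prod>a\<in>A. Poly_Mapping.single (f a) (1::'l::comm_ring_1)) = Poly_Mapping.single (sum f A) 1"
  by (induction A rule: infinite_finite_induct) (auto simp: mult_single)

lemma single_eq_prod_mvar:
  "Poly_Mapping.single e c =
    Poly_Mapping.single 0 c * (\<Prod>i\<in>UNIV. mvar i ^ Poly_Mapping.lookup e i)"
proof -
  have "(\<Sum>i\<in>UNIV. Poly_Mapping.single i (Poly_Mapping.lookup e i)) = e"
    by (rule poly_mapping_eqI) (auto simp: lookup_sum lookup_single when_def sum.delta)
  then show ?thesis by (simp add: mvar_power prod_single_one mult_single)
qed

lemma polys_in_all_variables:
  assumes "set vs = UNIV"
  shows "f \<in> polys_in vs"
proof -
  interpret type_subring "polys_in vs" by (rule polys_in_subring)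
  have prod: "(\<Prod>i\<in>A. mvar i ^ Poly_Mapping.lookup e i) \<in> polys_in vs" for A e
    by (induction A rule: infinite_finite_induct)
      (auto intro!: one_in mult_in power_in mvar_polys_in simp: assms)
  have "Poly_Mapping.single e c \<in> polys_in vs" for e c
    by (subst single_eq_prod_mvar) (intro mult_in const_polys_in prod)
  then have "(\<Sum>e\<in>Poly_Mapping.keys f. Poly_Mapping.single e (Poly_Mapping.lookup f e)) \<in> polys_in vs"
    by (intro sum_in)
  then show ?thesis by (simp only: sum_single_lookup)
qed

lemma comm_ring_map_id: "comm_ring_map id"
  by unfold_locales auto

lemma eval_mpoly_mvar: "comm_ring_map \<iota> \<Longrightarrow> eval_mpoly \<iota> x (mvar i) = x i"
  by (simp add: mvar_def eval_mpoly_single comm_ring_map.zero comm_ring_map.one lookup_single when_def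
      if_distrib[of "(^) _"] prod.delta cong: if_cong)

lemma eval_poly_mvar:
  "eval_mpoly id x (poly w (mvar i)) = poly (map_poly (eval_mpoly id x) w) (x i)"
  using comm_ring_map.poly_map_poly[OF eval_mpoly_hom[OF comm_ring_map_id], of x w "mvar i"]
  by (simp add: eval_mpoly_mvar comm_ring_map_id)

text \<open>Ensures that choosing a value for the next variable leaves evaluations in the earlier
  variables unchanged.\<close>

lemma eval_polys_in_cong:
  assumes "f \<in> polys_in vs" "\<And>i. i \<in> set vs \<Longrightarrow> x i = y i"
  shows "eval_mpoly id x f = eval_mpoly id y f"
  using assms
proof (induction vs arbitrary: f)
  case Nil
  then show ?case by (auto simp: eval_mpoly_single)
next
  case (Cons i vs)
  then obtain w where w: "f = poly w (mvar i)" "w \<in> coeffs_in (polys_in vs)" by auto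
  have "eval_mpoly id x (poly.coeff w n) = eval_mpoly id y (poly.coeff w n)" for n
    by (rule Cons.IH[OF coeffs_inD[OF w(2)]]) (use Cons.prems(2) in simp)
  then have "map_poly (eval_mpoly id x) w = map_poly (eval_mpoly id y) w"
    by (simp add: poly_eq_iff coeff_map_poly eval_mpoly_def[of _ _ 0])
  moreover have "x i = y i" using Cons.prems(2) by simp
  ultimately show ?case by (simp only: w(1) eval_poly_mvar)
qed

text \<open>The point is built one coordinate at a time by \<open>hom_extension\<close>. Each
  extension requires the earlier coordinates to avoid the zeros of some \<open>u\<close> outside
  \<open>Q\<close>, which is why the induction carries an arbitrary \<open>h\<close>.\<close>

lemma prime_ideal_zero_avoiding:
  fixes Q :: "('l::alg_closed_field, 'n::finite) mpoly set"
  assumes "type_prime_ideal Q" "h \<in> polys_in vs" "h \<notin> Q" "distinct vs"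
  shows "\<exists>x. (\<forall>f\<in>polys_in vs \<inter> Q. eval_mpoly id x f = 0) \<and> eval_mpoly id x h \<noteq> 0"
  using assms(2-)
proof (induction vs arbitrary: h)
  case Nil
  interpret type_prime_ideal Q by (rule assms)
  obtain c where h: "h = Poly_Mapping.single 0 c" using Nil by auto
  then have "c \<noteq> 0" using Nil zero_mem by auto
  \<comment> \<open>A nonzero constant is a unit, so a proper ideal contains none.\<close>
  have "a = 0" if "Poly_Mapping.single 0 a \<in> Q" for a
  proof (rule ccontr)
    assume "a \<noteq> 0"
    then have "Poly_Mapping.single 0 (inverse a) * Poly_Mapping.single 0 a = (1 :: ('l, 'n) mpoly)"
      by (simp add: mult_single)
    then show False using mult_mem[OF that] one_not_mem by metis
  qed
  then show ?case using \<open>c \<noteq> 0\<close> by (auto simp: h eval_mpoly_single)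
next
  case (Cons i vs)
  interpret type_prime_ideal Q by (rule assms)
  interpret type_subring "polys_in vs :: ('l, 'n) mpoly set" by (rule polys_in_subring)
  interpret subring_with_prime Q "polys_in vs" ..
  obtain q where q: "h = poly q (mvar i)" "q \<in> coeffs_in (polys_in vs)" using Cons by auto
  then have "poly q (mvar i) \<notin> Q" using Cons by simp
  from hom_extension[OF q(2) this, where ?'l = 'l] obtain u where u: "u \<in> polys_in vs" "u \<notin> Q"
    and ext: "\<And>\<phi> :: ('l, 'n) mpoly \<Rightarrow> 'l. \<lbrakk>comm_ring_map \<phi>;
        \<And>a. a \<in> polys_in vs \<Longrightarrow> a \<in> Q \<Longrightarrow> \<phi> a = 0; \<phi> u \<noteq> 0\<rbrakk> \<Longrightarrow>
      \<exists>\<xi>. (\<forall>w\<in>coeffs_in (polys_in vs). poly w (mvar i) \<in> Q \<longrightarrow> poly (map_poly \<phi> w) \<xi> = 0) \<and>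
        poly (map_poly \<phi> q) \<xi> \<noteq> 0" by metis
  have "distinct vs" using Cons.prems by simp
  from Cons.IH[OF u this] obtain x where x: "\<forall>f\<in>polys_in vs \<inter> Q. eval_mpoly id x f = 0"
    "eval_mpoly id x u \<noteq> 0" by blast
  obtain \<xi> where \<xi>: "\<And>w. w \<in> coeffs_in (polys_in vs) \<Longrightarrow> poly w (mvar i) \<in> Q \<Longrightarrow>
      poly (map_poly (eval_mpoly id x) w) \<xi> = 0" "poly (map_poly (eval_mpoly id x) q) \<xi> \<noteq> 0"
    using ext[OF eval_mpoly_hom[OF comm_ring_map_id]] x by blast
  \<comment> \<open>Since \<open>i\<close> does not occur in \<open>vs\<close>, the coefficients of
    \<open>w\<close> keep their values at \<open>x\<close>, and \<open>mvar i\<close> takes the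
    value \<open>\<xi>\<close>.\<close>
  have eval: "eval_mpoly id (x(i := \<xi>)) (poly w (mvar i)) = poly (map_poly (eval_mpoly id x) w) \<xi>"
    if "w \<in> coeffs_in (polys_in vs)" for w
  proof -
    have "map_poly (eval_mpoly id (x(i := \<xi>))) w = map_poly (eval_mpoly id x) w"
      using that Cons.prems
      by (auto simp: poly_eq_iff coeff_map_poly eval_mpoly_def[of _ _ 0] intro!: eval_polys_in_cong coeffs_inD)
    then show ?thesis by (simp add: eval_poly_mvar)
  qed
  have "eval_mpoly id (x(i := \<xi>)) f = 0" if "f \<in> polys_in (i # vs) \<inter> Q" for f
  proof -
    from that obtain w where w: "f = poly w (mvar i)" "w \<in> coeffs_in (polys_in vs)" by auto
    then show ?thesis using \<xi>(1)[OF w(2)] that by (simp only: w(1) eval[OF w(2)] Int_iff)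
  qed
  moreover have "eval_mpoly id (x(i := \<xi>)) h \<noteq> 0" using \<xi>(2) by (simp only: q(1) eval[OF q(2)] not_False_eq_True)
  ultimately show ?case by blast
qed

text \<open>The usual form is the contrapositive: if \<open>h\<close> vanishes at all zeros of
  \<open>I\<close>, then some power of \<open>h\<close> lies in \<open>I\<close>.\<close>

theorem nullstellensatz:
  fixes I :: "('l::alg_closed_field, 'n::finite) mpoly set"
  assumes "type_ideal I" "\<And>n. h ^ n \<notin> I"
  obtains x where "x \<in> zero_set id I" "eval_mpoly id x h \<noteq> 0"
proof -
  obtain Q where Q: "type_prime_ideal Q" "I \<subseteq> Q" "h \<notin> Q"
    using exists_prime_ideal_avoiding_powers assms by metis
  obtain vs :: "'n list" where vs: "set vs = UNIV" "distinct vs"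
    using finite_distinct_list[of "UNIV :: 'n set"] by auto
  then obtain x where x: "\<forall>f\<in>polys_in vs \<inter> Q. eval_mpoly id x f = 0" "eval_mpoly id x h \<noteq> 0"
    using prime_ideal_zero_avoiding[OF Q(1) _ Q(3)] polys_in_all_variables by blast
  then have "x \<in> zero_set id I"
    using Q(2) polys_in_all_variables[OF vs(1)] by (auto simp: zero_set_def)
  then show thesis using x that by blast
qed

section \<open>Extending a prime ideal to the large field\<close>

lemma primeideal_type_prime_ideal:
  fixes P :: "'a::comm_ring_1 set"
  assumes "primeideal P ring_of_type_algebra"
  shows "type_prime_ideal P"
proof -
  interpret P: primeideal P "ring_of_type_algebra :: 'a ring" by (rule assms)
  note [simp] = ring_of_type_algebra_def
  show ?thesis
  proof
    show "0 \<in> P" using additive_subgroup.zero_closed[OF P.is_additive_subgroup] by simp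
    show "a + b \<in> P" if "a \<in> P" "b \<in> P" for a b using additive_subgroup.a_closed[OF P.is_additive_subgroup that] by simp
    show "r * a \<in> P" if "a \<in> P" for a r using P.I_l_closed[OF that, of r] by simp
    show "1 \<notin> P" using P.one_imp_carrier P.I_notcarr by auto
    show "a \<in> P \<or> b \<in> P" if "a * b \<in> P" for a b using P.I_prime[of a b] that by simp
  qed
qed

section \<open>Coordinates of the large field over the small one\<close>

definition linear_functional :: "('k::field \<Rightarrow> 'l::field) \<Rightarrow> ('l \<Rightarrow> 'k) \<Rightarrow> bool" where
  "linear_functional \<iota> \<pi> \<longleftrightarrow>
     (\<forall>a b. \<pi> (a + b) = \<pi> a + \<pi> b) \<and> (\<forall>c a. \<pi> (\<iota> c * a) = c * \<pi> a)"

lemma linear_functional_add: "linear_functional \<iota> \<pi> \<Longrightarrow> \<pi> (a + b) = \<pi> a + \<pi> b"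
  by (simp add: linear_functional_def)

lemma linear_functional_scale: "linear_functional \<iota> \<pi> \<Longrightarrow> \<pi> (\<iota> c * a) = c * \<pi> a"
  by (simp add: linear_functional_def)

lemma linear_functional_zero: "linear_functional \<iota> \<pi> \<Longrightarrow> \<pi> 0 = 0"
  using linear_functional_scale[of \<iota> \<pi> 0 0] by simp

text \<open>Lets a scalar of the large field be absorbed into the functional; the extended ideal is
  closed under such scalars for this reason.\<close>

lemma linear_functional_compose_mult:
  "linear_functional \<iota> \<pi> \<Longrightarrow> linear_functional \<iota> (\<lambda>b. \<pi> (a * b))"
  by (auto simp: linear_functional_def distrib_left) (metis mult.left_commute)

text \<open>\<open>Poly_Mapping.map\<close> keeps zero coefficients at 0 whatever the function,
  hence the condition on \<open>\<pi>\<close>.\<close>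

lemma lookup_map: "\<pi> 0 = 0 \<Longrightarrow> Poly_Mapping.lookup (Poly_Mapping.map \<pi> f) e = \<pi> (Poly_Mapping.lookup f e)"
  by (simp add: Poly_Mapping.map.rep_eq when_def)

lemma pm_map_zero: "Poly_Mapping.map \<pi> 0 = 0"
  by (rule poly_mapping_eqI) (simp add: Poly_Mapping.map.rep_eq)

lemma pm_map_add:
  assumes "\<pi> 0 = 0" "\<And>a b. \<pi> (a + b) = \<pi> a + \<pi> b"
  shows "Poly_Mapping.map \<pi> (f + g) = Poly_Mapping.map \<pi> f + Poly_Mapping.map \<pi> g"
  by (rule poly_mapping_eqI) (simp add: lookup_map lookup_add assms)

lemma pm_map_sum:
  assumes "\<pi> 0 = 0" "\<And>a b. \<pi> (a + b) = \<pi> a + \<pi> b"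
  shows "Poly_Mapping.map \<pi> (sum F A) = (\<Sum>a\<in>A. Poly_Mapping.map \<pi> (F a))"
proof (induction A rule: infinite_finite_induct)
  case (insert a A)
  then show ?case by (simp add: pm_map_add assms)
qed (simp_all add: poly_mapping_eq_iff lookup_map fun_eq_iff assms)

text \<open>Both sides are biadditive, so monomials suffice. Three maps are allowed in order to
  cover both \<open>\<rho> = \<iota>\<close> with \<open>\<sigma> = \<pi>\<close>, and
  \<open>\<rho>\<close>, \<open>\<sigma>\<close> twisted by a scalar \<open>a\<close> of the large
  field.\<close>

lemma pm_map_mult:
  assumes zero: "\<pi> 0 = 0" "\<rho> 0 = 0" "\<sigma> 0 = 0"
    and add: "\<And>a b. \<pi> (a + b) = \<pi> a + \<pi> b" "\<And>a b. \<rho> (a + b) = \<rho> a + \<rho> b" "\<And>a b. \<sigma> (a + b) = \<sigma> a + \<sigma> b"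
    and mult: "\<And>a b. \<pi> (\<rho> a * b) = a * \<sigma> b"
  shows "Poly_Mapping.map \<pi> (Poly_Mapping.map \<rho> f * g) = f * Poly_Mapping.map \<sigma> g"
proof -
  let ?f = "\<lambda>e. Poly_Mapping.single e (Poly_Mapping.lookup f e)"
  let ?g = "\<lambda>e. Poly_Mapping.single e (Poly_Mapping.lookup g e)"
  have "Poly_Mapping.map \<pi> (Poly_Mapping.map \<rho> (sum ?f (Poly_Mapping.keys f)) * sum ?g (Poly_Mapping.keys g))
     = sum ?f (Poly_Mapping.keys f) * Poly_Mapping.map \<sigma> (sum ?g (Poly_Mapping.keys g))"
    by (simp add: pm_map_sum zero add sum_product map_single mult_single mult)
  then show ?thesis by (simp only: sum_single_lookup)
qed


lemma eval_mpoly_map: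
  assumes "\<iota> 0 = 0"
  shows "eval_mpoly id x (Poly_Mapping.map \<iota> f) = eval_mpoly \<iota> x f"
proof -
  have "Poly_Mapping.keys (Poly_Mapping.map \<iota> f) \<subseteq> Poly_Mapping.keys f"
    using assms by (auto simp: in_keys_iff lookup_map)
  then have "eval_mpoly id x (Poly_Mapping.map \<iota> f) = (\<Sum>e\<in>Poly_Mapping.keys f.
      id (Poly_Mapping.lookup (Poly_Mapping.map \<iota> f) e) * (\<Prod>i\<in>UNIV. x i ^ Poly_Mapping.lookup e i))"
    by (intro eval_mpoly_superset) auto
  then show ?thesis using assms by (simp add: eval_mpoly_def lookup_map)
qed

text \<open>The functionals are the coordinates for a basis of \<open>'l\<close> over
  \<open>'k\<close>; \<open>B\<close> collects the finitely many basis vectors that occur in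
  elements of \<open>A\<close>.\<close>

lemma finite_dual_expansion:
  fixes \<iota> :: "'k::field \<Rightarrow> 'l::field"
  assumes "comm_ring_map \<iota>" "finite A"
  shows "\<exists>B (\<pi> :: 'l \<Rightarrow> 'l \<Rightarrow> 'k). finite B \<and> (\<forall>b. linear_functional \<iota> (\<pi> b)) \<and>
    (\<forall>a\<in>A. (\<Sum>b\<in>B. \<iota> (\<pi> b a) * b) = a)"
proof -
  interpret \<iota>: comm_ring_map \<iota> by (rule assms)
  interpret V: vector_space "\<lambda>c a. \<iota> c * a"
    by unfold_locales (simp_all add: algebra_simps \<iota>.add \<iota>.mult)
  define E where "E = V.extend_basis {}"
  have ind: "V.independent E" and span: "V.span E = UNIV"
    unfolding E_def by (auto intro!: V.independent_extend_basis V.span_extend_basis V.independent_empty)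
  define \<pi> where "\<pi> b a = V.representation E a b" for b a
  define B where "B = (\<Union>a\<in>A. {b. \<pi> b a \<noteq> 0})"
  have "linear_functional \<iota> (\<pi> b)" for b
    unfolding linear_functional_def \<pi>_def
    by (simp add: V.representation_add[OF ind] V.representation_scale[OF ind] span)
  moreover have fin: "finite B"
    unfolding B_def \<pi>_def using assms(2) by (auto intro: V.finite_representation)
  moreover have "(\<Sum>b\<in>B. \<iota> (\<pi> b a) * b) = a" if "a \<in> A" for a
  proof -
    have "(\<Sum>b\<in>B. \<iota> (\<pi> b a) * b) = (\<Sum>b | \<pi> b a \<noteq> 0. \<iota> (\<pi> b a) * b)"
      using fin that by (intro sum.mono_neutral_right) (auto simp: B_def)
    also have "\<dots> = a"
      unfolding \<pi>_def using V.sum_nonzero_representation_eq[OF ind, of a] span by simp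
    finally show ?thesis .
  qed
  ultimately show ?thesis by blast
qed

text \<open>The extension of \<open>P\<close> to polynomials over the large field, described by coordinates: linear
  functionals \<open>'l \<Rightarrow> 'k\<close>, applied coefficientwise, take it to \<open>P\<close>. In this form it is evident
  that elements outside a prime \<open>P\<close> stay non-zero-divisors modulo the extension.\<close>
definition extended_ideal ::
    "('k::field \<Rightarrow> 'l::field) \<Rightarrow> ('k, 'n::finite) mpoly set \<Rightarrow> ('l, 'n) mpoly set" where
  "extended_ideal \<iota> P = {g. \<forall>\<pi>. linear_functional \<iota> \<pi> \<longrightarrow> Poly_Mapping.map \<pi> g \<in> P}"

locale prime_of_extension = comm_ring_map \<iota> + P: type_prime_ideal P
  for \<iota> :: "'k::field \<Rightarrow> 'l::field" and P :: "('k, 'n::finite) mpoly set"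
begin

lemma map_functional_mult:
  assumes "linear_functional \<iota> \<pi>"
  shows "Poly_Mapping.map \<pi> (Poly_Mapping.map \<iota> f * g) = f * Poly_Mapping.map \<pi> g"
  using linear_functional_add[OF assms] linear_functional_scale[OF assms]
    linear_functional_zero[OF assms] zero add by (intro pm_map_mult) auto

lemma map_functional_power_mult:
  assumes "linear_functional \<iota> \<pi>"
  shows "Poly_Mapping.map \<pi> (Poly_Mapping.map \<iota> f ^ n * g) = f ^ n * Poly_Mapping.map \<pi> g"
  by (induction n) (auto simp: mult.assoc map_functional_mult[OF assms])

lemma extended_ideal: "type_ideal (extended_ideal \<iota> P)"
proof
  show "0 \<in> extended_ideal \<iota> P"
    using P.zero_mem by (simp add: extended_ideal_def pm_map_zero)
next
  fix g h assume "g \<in> extended_ideal \<iota> P" "h \<in> extended_ideal \<iota> P"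
  then show "g + h \<in> extended_ideal \<iota> P" unfolding extended_ideal_def
    by (auto simp: pm_map_add linear_functional_zero linear_functional_add intro: P.add_mem)
next
  fix g r assume g: "g \<in> extended_ideal \<iota> P"
  have "Poly_Mapping.map \<pi> (r * g) \<in> P" if \<pi>: "linear_functional \<iota> \<pi>" for \<pi>
  proof -
    note \<pi>0 = linear_functional_zero[OF \<pi>]
    \<comment> \<open>For a monomial factor, the scalar \<open>a\<close> moves into the functional
      and the pure monomial multiplies an element of \<open>P\<close>.\<close>
    have single: "Poly_Mapping.map \<pi> (Poly_Mapping.single e a * g) \<in> P" for e a
    proof -
      have scale: "\<pi> (a * \<iota> c * b) = c * \<pi> (a * b)" for b c
        using linear_functional_scale[OF \<pi>, of c "a * b"] by (simp add: ac_simps)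
      have "Poly_Mapping.map \<pi> (Poly_Mapping.map (\<lambda>c. a * \<iota> c) (Poly_Mapping.single e 1) * g)
          = Poly_Mapping.single e 1 * Poly_Mapping.map (\<lambda>b. \<pi> (a * b)) g"
        by (rule pm_map_mult)
          (simp_all add: \<pi>0 linear_functional_add[OF \<pi>] add scale distrib_left)
      moreover have "Poly_Mapping.map (\<lambda>c. a * \<iota> c) (Poly_Mapping.single e 1) = Poly_Mapping.single e a"
        by (rule poly_mapping_eqI) (simp add: lookup_map lookup_single when_def)
      ultimately show ?thesis
        using g linear_functional_compose_mult[OF \<pi>, of a]
        by (auto simp: extended_ideal_def intro: P.mult_mem)
    qed
    have "Poly_Mapping.map \<pi> ((\<Sum>e\<in>Poly_Mapping.keys r. Poly_Mapping.single e (Poly_Mapping.lookup r e)) * g) \<in> P"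
      unfolding sum_distrib_right
      by (subst pm_map_sum) (auto simp: \<pi>0 linear_functional_add[OF \<pi>] intro: P.sum_mem single)
    then show ?thesis by (simp only: sum_single_lookup)
  qed
  then show "r * g \<in> extended_ideal \<iota> P" by (simp add: extended_ideal_def)
qed

lemma map_mem_extended_ideal: "p \<in> P \<Longrightarrow> Poly_Mapping.map \<iota> p \<in> extended_ideal \<iota> P"
  using map_functional_mult[of _ p 1] by (auto simp: extended_ideal_def intro: P.mult_mem_right)

text \<open>A functional lets the factor from the small field pass through, so in each coordinate
  the claim is just that \<open>P\<close> is prime.\<close>

lemma power_mult_mem_extended_ideal:
  assumes "f \<notin> P" "Poly_Mapping.map \<iota> f ^ n * g \<in> extended_ideal \<iota> P"
  shows "g \<in> extended_ideal \<iota> P"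
  using assms
  by (auto simp: extended_ideal_def map_functional_power_mult P.mult_mem_iff P.power_mem_iff)

text \<open>Expanding the coefficients of \<open>g\<close> in a basis writes its value at
  \<open>x\<close> as a linear combination of values of its coordinate polynomials, which lie in
  \<open>P\<close>.\<close>

lemma eval_extended_ideal:
  assumes x: "x \<in> zero_set \<iota> P" and g: "g \<in> extended_ideal \<iota> P"
  shows "eval_mpoly id x g = 0"
proof -
  let ?m = "\<lambda>e. \<Prod>i\<in>UNIV. x i ^ Poly_Mapping.lookup e i"
  obtain B and \<pi> :: "'l \<Rightarrow> 'l \<Rightarrow> 'k" where B: "finite B" "\<And>b. linear_functional \<iota> (\<pi> b)"
    "\<forall>a\<in>Poly_Mapping.lookup g ` Poly_Mapping.keys g. (\<Sum>b\<in>B. \<iota> (\<pi> b a) * b) = a"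
    using finite_dual_expansion[OF comm_ring_map_axioms, of "Poly_Mapping.lookup g ` Poly_Mapping.keys g"]
    by auto
  have "eval_mpoly id x g =
      (\<Sum>e\<in>Poly_Mapping.keys g. (\<Sum>b\<in>B. \<iota> (\<pi> b (Poly_Mapping.lookup g e)) * b) * ?m e)"
    unfolding eval_mpoly_def using B(3) by (intro sum.cong) auto
  also have "\<dots> = (\<Sum>b\<in>B. b * (\<Sum>e\<in>Poly_Mapping.keys g. \<iota> (\<pi> b (Poly_Mapping.lookup g e)) * ?m e))"
    by (simp add: sum_distrib_left sum_distrib_right ac_simps) (rule sum.swap)
  also have "\<dots> = (\<Sum>b\<in>B. b * eval_mpoly \<iota> x (Poly_Mapping.map (\<pi> b) g))"
  proof (intro sum.cong refl arg_cong2[where f = "(*)"])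
    fix b
    have "Poly_Mapping.keys (Poly_Mapping.map (\<pi> b) g) \<subseteq> Poly_Mapping.keys g"
      by (auto simp: in_keys_iff lookup_map linear_functional_zero[OF B(2)])
    then show "(\<Sum>e\<in>Poly_Mapping.keys g. \<iota> (\<pi> b (Poly_Mapping.lookup g e)) * ?m e) =
        eval_mpoly \<iota> x (Poly_Mapping.map (\<pi> b) g)"
      by (subst eval_mpoly_superset[where E = "Poly_Mapping.keys g"])
        (auto simp: lookup_map linear_functional_zero[OF B(2)])
  qed
  also have "\<dots> = 0" using x g B(2) by (auto simp: zero_set_def extended_ideal_def)
  finally show ?thesis .
qed

text \<open>Some coordinate of 1 is nonzero and would put a unit into \<open>P\<close>.\<close>

lemma one_not_mem_extended_ideal: "1 \<notin> extended_ideal \<iota> P"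
proof
  assume one_mem: "1 \<in> extended_ideal \<iota> P"
  obtain B and \<pi> :: "'l \<Rightarrow> 'l \<Rightarrow> 'k" where B: "\<And>b. linear_functional \<iota> (\<pi> b)"
    "(\<Sum>b\<in>B. \<iota> (\<pi> b 1) * b) = 1"
    using finite_dual_expansion[OF comm_ring_map_axioms, of "{1}"] by auto
  have "\<pi> b 1 = 0" for b
  proof (rule ccontr)
    assume "\<pi> b 1 \<noteq> 0"
    have "Poly_Mapping.map (\<pi> b) 1 = Poly_Mapping.single 0 (\<pi> b 1)"
      by (rule poly_mapping_eqI)
        (simp add: lookup_map linear_functional_zero[OF B(1)] lookup_one lookup_single when_def)
    then have "Poly_Mapping.single 0 (\<pi> b 1) \<in> P"
      using one_mem B(1) unfolding extended_ideal_def by (metis (mono_tags, lifting) mem_Collect_eq)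
    then have "Poly_Mapping.single 0 (inverse (\<pi> b 1)) * Poly_Mapping.single 0 (\<pi> b 1) \<in> P"
      by (rule P.mult_mem)
    then show False using P.one_not_mem \<open>\<pi> b 1 \<noteq> 0\<close> by (simp add: mult_single)
  qed
  then show False using B(2) by simp
qed

end

locale prime_of_alg_closed_extension = prime_of_extension \<iota> P
  for \<iota> :: "'k::field \<Rightarrow> 'l::alg_closed_field" and P :: "('k, 'n::finite) mpoly set"
begin

text \<open>A power of the product of \<open>f\<close> and \<open>g\<close> in the extension would,
  after cancelling \<open>f\<close>, put a power of \<open>g\<close> there. The Nullstellensatz
  therefore applies to the product.\<close>

lemma zero_avoiding:
  assumes "f \<notin> P" "\<And>n. g ^ n \<notin> extended_ideal \<iota> P"
  obtains x where "x \<in> zero_set \<iota> P" "eval_mpoly \<iota> x f \<noteq> 0" "eval_mpoly id x g \<noteq> 0"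
proof -
  have "(Poly_Mapping.map \<iota> f * g) ^ n \<notin> extended_ideal \<iota> P" for n
    unfolding power_mult_distrib using power_mult_mem_extended_ideal assms by blast
  from nullstellensatz[OF extended_ideal this] obtain x where
    x: "x \<in> zero_set id (extended_ideal \<iota> P)" "eval_mpoly id x (Poly_Mapping.map \<iota> f * g) \<noteq> 0" by blast
  have "eval_mpoly \<iota> x p = 0" if "p \<in> P" for p
    using x(1) map_mem_extended_ideal[OF that] by (auto simp: zero_set_def simp flip: eval_mpoly_map[of \<iota>, OF zero])
  then have "x \<in> zero_set \<iota> P" by (simp add: zero_set_def)
  moreover have "eval_mpoly id x (Poly_Mapping.map \<iota> f * g) =
      eval_mpoly id x (Poly_Mapping.map \<iota> f) * eval_mpoly id x g"
    by (rule comm_ring_map.mult[OF eval_mpoly_hom[OF comm_ring_map_id]])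
  moreover have "eval_mpoly id x (Poly_Mapping.map \<iota> f) = eval_mpoly \<iota> x f"
    by (rule eval_mpoly_map) (rule zero)
  ultimately show thesis using that x(2) by (metis mult_not_zero)
qed

lemma zero_set_not_covered:
  assumes "f \<notin> P"
  obtains x where "x \<in> zero_set \<iota> P" "eval_mpoly \<iota> x f \<noteq> 0"
  \<comment> \<open>With \<open>g = 1\<close> the condition on powers says that the extension is
    proper.\<close>
  using zero_avoiding[OF assms, of 1] one_not_mem_extended_ideal by auto

text \<open>The extension vanishes at \<open>x\<^sub>0\<close>, so no power of \<open>g\<close> can
  belong to it. Here \<open>g\<close> has coefficients in the large field, as the closed sets
  demand.\<close>

lemma zero_set_dense:
  assumes "f \<notin> P" "x\<^sub>0 \<in> zero_set \<iota> P" "eval_mpoly id x\<^sub>0 g \<noteq> 0"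
  obtains x where "x \<in> zero_set \<iota> P" "eval_mpoly \<iota> x f \<noteq> 0" "eval_mpoly id x g \<noteq> 0"
proof (rule zero_avoiding[OF assms(1)])
  fix n
  show "g ^ n \<notin> extended_ideal \<iota> P"
    using eval_extended_ideal[OF assms(2)] assms(3) comm_ring_map.power[OF eval_mpoly_hom[OF comm_ring_map_id]]
    by (metis power_not_zero)
qed

end

section \<open>Zariski closures\<close>

lemma zariski_closed_zero_set:
  assumes "comm_ring_map \<iota>"
  shows "zariski_closed (zero_set \<iota> P)"
proof -
  have "zero_set \<iota> P = zero_set id (Poly_Mapping.map \<iota> ` P)"
    by (simp add: zero_set_def eval_mpoly_map[of \<iota>, OF comm_ring_map.zero[OF assms]])
  then show ?thesis unfolding zariski_closed_def by blast
qed

lemma zariski_closed_empty: "zariski_closed ({} :: ('n::finite \<Rightarrow> 'l::field) set)"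
proof -
  have "eval_mpoly id x 1 = 1" for x :: "'n \<Rightarrow> 'l"
    by (rule comm_ring_map.one[OF eval_mpoly_hom[OF comm_ring_map_id]])
  then have "zero_set id {1} = ({} :: ('n \<Rightarrow> 'l) set)" by (simp add: zero_set_def)
  then show ?thesis unfolding zariski_closed_def by blast
qed

lemma zariski_closed_Un:
  fixes Z W :: "('n::finite \<Rightarrow> 'l::field) set"
  assumes "zariski_closed Z" "zariski_closed W"
  shows "zariski_closed (Z \<union> W)"
proof -
  from assms obtain F G :: "('l, 'n) mpoly set" where FG: "Z = zero_set id F" "W = zero_set id G"
    unfolding zariski_closed_def by blast
  have mult: "eval_mpoly id x (f * g) = eval_mpoly id x f * eval_mpoly id x g"
    for x and f g :: "('l, 'n) mpoly"
    by (rule comm_ring_map.mult[OF eval_mpoly_hom[OF comm_ring_map_id]])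
  have "Z \<union> W = zero_set id {f * g | f g. f \<in> F \<and> g \<in> G}"
  proof (intro equalityI subsetI)
    fix x assume "x \<in> Z \<union> W"
    then show "x \<in> zero_set id {f * g | f g. f \<in> F \<and> g \<in> G}"
      unfolding FG zero_set_def by (force simp: mult)
  next
    fix x assume x: "x \<in> zero_set id {f * g | f g. f \<in> F \<and> g \<in> G}"
    show "x \<in> Z \<union> W"
    proof (rule ccontr)
      assume "x \<notin> Z \<union> W"
      then obtain f g where "f \<in> F" "g \<in> G" "eval_mpoly id x f \<noteq> 0" "eval_mpoly id x g \<noteq> 0"
        unfolding FG zero_set_def by blast
      moreover from this have "eval_mpoly id x (f * g) = 0" using x unfolding zero_set_def by blast
      ultimately show False using mult[of x f g] by (metis mult_eq_0_iff)
    qed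
  qed
  then show ?thesis unfolding zariski_closed_def by blast
qed

lemma zariski_closed_UN:
  assumes "finite A" "\<And>a. a \<in> A \<Longrightarrow> zariski_closed (Z a)"
  shows "zariski_closed (\<Union>a\<in>A. Z a)"
  using assms by (induction A) (auto intro: zariski_closed_empty zariski_closed_Un)

lemma zariski_closure_eqI:
  assumes "Y \<subseteq> Z" "zariski_closed Z"
    and "\<And>F. Y \<subseteq> zero_set id F \<Longrightarrow> Z \<subseteq> zero_set id F"
  shows "zariski_closure Y = Z"
  unfolding zariski_closure_def
proof (rule hull_unique)
  fix W assume "Y \<subseteq> W" "zariski_closed W"
  then show "Z \<subseteq> W" using assms(3) unfolding zariski_closed_def by blast
qed (use assms in auto)

lemma zariski_closure_subset: "Y \<subseteq> zariski_closure Y"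
  unfolding zariski_closure_def by (rule hull_subset)

lemma zariski_closure_mono: "Y \<subseteq> Z \<Longrightarrow> zariski_closure Y \<subseteq> zariski_closure Z"
  unfolding zariski_closure_def by (rule hull_mono)

lemma zariski_closure_minimal: "Y \<subseteq> Z \<Longrightarrow> zariski_closed Z \<Longrightarrow> zariski_closure Y \<subseteq> Z"
  unfolding zariski_closure_def by (rule hull_minimal)

lemma zariski_closure_UN:
  assumes "finite A" "\<And>a. a \<in> A \<Longrightarrow> zariski_closure (Y a) = Z a" "\<And>a. a \<in> A \<Longrightarrow> zariski_closed (Z a)"
  shows "zariski_closure (\<Union>a\<in>A. Y a) = (\<Union>a\<in>A. Z a)"
proof
  show "zariski_closure (\<Union>a\<in>A. Y a) \<subseteq> (\<Union>a\<in>A. Z a)"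
    using assms zariski_closure_subset by (intro zariski_closure_minimal zariski_closed_UN) blast+
  show "(\<Union>a\<in>A. Z a) \<subseteq> zariski_closure (\<Union>a\<in>A. Y a)"
    using assms(2) zariski_closure_mono[OF UN_upper, of _ A Y] by blast
qed

section \<open>Density and irreducibility for zero sets of primes\<close>

context prime_of_alg_closed_extension
begin

text \<open>Take the product of one element of each \<open>Q\<close> outside \<open>P\<close>: it
  stays outside the prime \<open>P\<close> and vanishes on all the zero sets.\<close>

lemma avoid_finitely_many_ideals:
  assumes "finite \<Q>" "\<And>Q. Q \<in> \<Q> \<Longrightarrow> \<not> Q \<subseteq> P"
  obtains f where "f \<notin> P" "\<And>x Q. Q \<in> \<Q> \<Longrightarrow> eval_mpoly \<iota> x f \<noteq> 0 \<Longrightarrow> x \<notin> zero_set \<iota> Q"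
proof -
  have "\<forall>Q\<in>\<Q>. \<exists>f. f \<in> Q \<and> f \<notin> P" using assms(2) by blast
  then obtain F where F: "\<forall>Q\<in>\<Q>. F Q \<in> Q \<and> F Q \<notin> P" by (rule bchoice[THEN exE])
  have "prod F \<Q> \<notin> P" using F by (intro P.prod_not_mem) blast
  moreover have "x \<notin> zero_set \<iota> Q" if Q: "Q \<in> \<Q>" and x: "eval_mpoly \<iota> x (prod F \<Q>) \<noteq> 0" for x Q
  proof
    assume "x \<in> zero_set \<iota> Q"
    then have "eval_mpoly \<iota> x (F Q) = 0" using F Q by (auto simp: zero_set_def)
    moreover have "prod F \<Q> = F Q * prod F (\<Q> - {Q})" using Q assms(1) by (simp add: prod.remove)
    ultimately show False using x comm_ring_map.mult[OF eval_mpoly_hom[OF comm_ring_map_axioms]]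
      by (metis mult_zero_left)
  qed
  ultimately show thesis using that by blast
qed

text \<open>\<open>Y\<close> is only bounded from both sides because the set of a child may be
  smaller than the zero set of its ideal.\<close>

lemma zariski_closure_diff:
  assumes "finite \<Q>" "\<And>Q. Q \<in> \<Q> \<Longrightarrow> \<not> Q \<subseteq> P"
    and "zero_set \<iota> P - (\<Union>Q\<in>\<Q>. zero_set \<iota> Q) \<subseteq> Y" "Y \<subseteq> zero_set \<iota> P"
  shows "zariski_closure Y = zero_set \<iota> P"
proof (rule zariski_closure_eqI)
  obtain f where f: "f \<notin> P" "\<And>x Q. Q \<in> \<Q> \<Longrightarrow> eval_mpoly \<iota> x f \<noteq> 0 \<Longrightarrow> x \<notin> zero_set \<iota> Q"
    using avoid_finitely_many_ideals assms(1,2) by metis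
  fix F assume F: "Y \<subseteq> zero_set id F"
  show "zero_set \<iota> P \<subseteq> zero_set id F"
  proof
    fix y assume y: "y \<in> zero_set \<iota> P"
    have "eval_mpoly id y g = 0" if "g \<in> F" for g
    proof (rule ccontr)
      assume "eval_mpoly id y g \<noteq> 0"
      from zero_set_dense[OF f(1) y this] obtain x where
        x: "x \<in> zero_set \<iota> P" "eval_mpoly \<iota> x f \<noteq> 0" "eval_mpoly id x g \<noteq> 0" by blast
      then have "x \<in> Y" using f(2) assms(3) by blast
      then show False using F x(3) that by (auto simp: zero_set_def)
    qed
    then show "y \<in> zero_set id F" by (simp add: zero_set_def)
  qed
qed (use assms zariski_closed_zero_set[OF comm_ring_map_axioms] in auto)

text \<open>Otherwise a single \<open>f\<close> outside \<open>P\<close> vanishes on the whole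
  cover, but not on all zeros of \<open>P\<close>. Coverings thus turn into inclusions of
  ideals.\<close>

lemma zero_set_covered:
  assumes "finite \<Q>" "zero_set \<iota> P \<subseteq> (\<Union>Q\<in>\<Q>. zero_set \<iota> Q)"
  shows "\<exists>Q\<in>\<Q>. Q \<subseteq> P"
proof (rule ccontr)
  assume "\<not> (\<exists>Q\<in>\<Q>. Q \<subseteq> P)"
  then obtain f where f: "f \<notin> P" "\<And>x Q. Q \<in> \<Q> \<Longrightarrow> eval_mpoly \<iota> x f \<noteq> 0 \<Longrightarrow> x \<notin> zero_set \<iota> Q"
    using avoid_finitely_many_ideals[OF assms(1)] by metis
  obtain x where "x \<in> zero_set \<iota> P" "eval_mpoly \<iota> x f \<noteq> 0" using zero_set_not_covered f(1) by blast
  then show False using f(2) assms(2) by blast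
qed

end

section \<open>Generalized canonical specifications\<close>

lemma zero_set_antimono: "P \<subseteq> Q \<Longrightarrow> zero_set \<iota> Q \<subseteq> zero_set \<iota> P"
  by (auto simp: zero_set_def)

lemma C_node_eq:
  "C_node \<iota> N = zero_set \<iota> (node_ideal N) - (\<Union>M\<in>fset (node_children N). C_node \<iota> M)"
  by (cases N) simp

lemma C_node_subset: "C_node \<iota> N \<subseteq> zero_set \<iota> (node_ideal N)"
  unfolding C_node_eq[of \<iota> N] by blast

lemma C_node_gcs:
  "is_gcs \<iota> T S \<Longrightarrow> vertex_at T j N \<Longrightarrow>
    C_node \<iota> N = zero_set \<iota> (node_ideal N) \<inter> (if odd j then S else - S)"
  unfolding is_gcs_def by blast

text \<open>The sets of the children lie inside the zero set of their parent, so the subtraction can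
  be undone: a node's ideal and set determine the union over its children.\<close>

lemma Union_C_node_children:
  assumes "\<And>M. M |\<in>| node_children N \<Longrightarrow> node_ideal N \<subseteq> node_ideal M"
  shows "(\<Union>M\<in>fset (node_children N). C_node \<iota> M) = zero_set \<iota> (node_ideal N) - C_node \<iota> N"
proof -
  have "C_node \<iota> M \<subseteq> zero_set \<iota> (node_ideal N)" if "M |\<in>| node_children N" for M
    using C_node_subset[of \<iota> M] zero_set_antimono[OF assms[OF that], of \<iota>] by blast
  then show ?thesis using C_node_eq[of \<iota> N] by blast
qed

locale alg_closed_extension = comm_ring_map \<iota> for \<iota> :: "'k::field \<Rightarrow> 'l::alg_closed_field"
begin

lemma prime_extensionI:
  "primeideal P ring_of_type_algebra \<Longrightarrow> prime_of_alg_closed_extension \<iota> P"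
  by (intro prime_of_alg_closed_extension.intro prime_of_extension.intro comm_ring_map_axioms
      primeideal_type_prime_ideal)

text \<open>The children remove only zeros of strictly larger ideals, and the rest is dense.\<close>

lemma closure_C_node:
  assumes "is_ptree T" "vertex_at T j N"
  shows "zariski_closure (C_node \<iota> N) = zero_set \<iota> (node_ideal N)"
proof -
  interpret prime_of_alg_closed_extension \<iota> "node_ideal N"
    using assms by (intro prime_extensionI) (auto simp: is_ptree_def)
  show ?thesis
  proof (rule zariski_closure_diff)
    show "finite (node_ideal ` fset (node_children N))" by simp
    show "\<not> Q \<subseteq> node_ideal N" if "Q \<in> node_ideal ` fset (node_children N)" for Q
      using that assms unfolding is_ptree_def by blast
    show "zero_set \<iota> (node_ideal N) - (\<Union>Q\<in>node_ideal ` fset (node_children N). zero_set \<iota> Q) \<subseteq> C_node \<iota> N"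
      unfolding C_node_eq[of \<iota> N] using C_node_subset[of \<iota>] by blast
    show "C_node \<iota> N \<subseteq> zero_set \<iota> (node_ideal N)" by (rule C_node_subset)
  qed
qed

text \<open>Taking closures turns \<open>eq\<close> into an equality of finite unions of zero sets
  of primes. Covering back and forth gives ideals of \<open>N'\<close>, \<open>M\<close>,
  \<open>N\<close> in ascending order, and irredundance makes \<open>N'\<close> equal to
  \<open>N\<close>.\<close>

lemma sibling_ideals_determined:
  assumes Ns: "\<And>N. N |\<in>| Ns \<Longrightarrow> primeideal (node_ideal N) ring_of_type_algebra"
      "\<And>N. N |\<in>| Ns \<Longrightarrow> zariski_closure (C_node \<iota> N) = zero_set \<iota> (node_ideal N)" "irredundant Ns"
    and Ms: "\<And>M. M |\<in>| Ms \<Longrightarrow> primeideal (node_ideal M) ring_of_type_algebra"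
      "\<And>M. M |\<in>| Ms \<Longrightarrow> zariski_closure (C_node \<iota> M) = zero_set \<iota> (node_ideal M)"
    and eq: "(\<Union>N\<in>fset Ns. C_node \<iota> N) = (\<Union>M\<in>fset Ms. C_node \<iota> M)"
    and N: "N |\<in>| Ns"
  obtains M where "M |\<in>| Ms" "node_ideal M = node_ideal N"
proof -
  have zeros: "(\<Union>N\<in>fset Ns. zero_set \<iota> (node_ideal N)) = (\<Union>M\<in>fset Ms. zero_set \<iota> (node_ideal M))"
    using zariski_closure_UN[of "fset Ns" "C_node \<iota>"] zariski_closure_UN[of "fset Ms" "C_node \<iota>"]
      Ns(2) Ms(2) eq zariski_closed_zero_set[OF comm_ring_map_axioms]
    by (metis (no_types, lifting) finite_fset)
  interpret N: prime_of_alg_closed_extension \<iota> "node_ideal N" using Ns(1)[OF N] by (rule prime_extensionI)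
  obtain M where M: "M |\<in>| Ms" "node_ideal M \<subseteq> node_ideal N"
    using N.zero_set_covered[of "node_ideal ` fset Ms"] N zeros by fastforce
  interpret M: prime_of_alg_closed_extension \<iota> "node_ideal M" using Ms(1)[OF M(1)] by (rule prime_extensionI)
  obtain N' where N': "N' |\<in>| Ns" "node_ideal N' \<subseteq> node_ideal M"
    using M.zero_set_covered[of "node_ideal ` fset Ns"] M(1) zeros by fastforce
  have "N' = N" using Ns(3) N N' M(2) unfolding irredundant_def by blast
  then show thesis using that M N' by blast
qed

text \<open>The level is part of the statement because its parity decides whether \<open>S\<close>
  or its complement cuts out \<open>C_node\<close>.\<close>

lemma gcs_node_unique:
  assumes T: "is_gcs \<iota> T S" and T': "is_gcs \<iota> T' S"
  shows "vertex_at T j N \<Longrightarrow> vertex_at T' j M \<Longrightarrow> node_ideal N = node_ideal M \<Longrightarrow> N = M"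
proof (induction N arbitrary: j M)
  case (PNode P Ns)
  let ?N = "PNode P Ns"
  have pT: "is_ptree T" and pT': "is_ptree T'" using T T' by (auto simp: is_gcs_def)
  have C: "C_node \<iota> ?N = C_node \<iota> M"
    using C_node_gcs[OF T PNode.prems(1)] C_node_gcs[OF T' PNode.prems(2)] PNode.prems(3) by metis
  have subN: "node_ideal ?N \<subseteq> node_ideal N'" if "N' |\<in>| node_children ?N" for N'
    using pT PNode.prems(1) that unfolding is_ptree_def by blast
  have subM: "node_ideal M \<subseteq> node_ideal M'" if "M' |\<in>| node_children M" for M'
    using pT' PNode.prems(2) that unfolding is_ptree_def by blast
  have eq: "(\<Union>N\<in>fset Ns. C_node \<iota> N) = (\<Union>M\<in>fset (node_children M). C_node \<iota> M)"
  proof -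
    have "(\<Union>N\<in>fset (node_children ?N). C_node \<iota> N) = zero_set \<iota> (node_ideal ?N) - C_node \<iota> ?N"
      using subN by (rule Union_C_node_children)
    also have "\<dots> = zero_set \<iota> (node_ideal M) - C_node \<iota> M" by (simp only: C PNode.prems(3))
    also have "\<dots> = (\<Union>M\<in>fset (node_children M). C_node \<iota> M)"
      by (rule Union_C_node_children[OF subM, symmetric])
    finally show ?thesis by (simp only: pnode.sel)
  qed
  have vN: "vertex_at T (Suc j) N'" if "N' |\<in>| Ns" for N'
    using vertex_at.intros(2)[OF PNode.prems(1)] that by simp
  have vM: "vertex_at T' (Suc j) M'" if "M' |\<in>| node_children M" for M'
    using vertex_at.intros(2)[OF PNode.prems(2)] that by simp
  have irr: "irredundant Ns" "irredundant (node_children M)"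
    using pT pT' PNode.prems unfolding is_ptree_def by (metis pnode.sel(2), metis)
  have primes: "N' |\<in>| Ns \<Longrightarrow> primeideal (node_ideal N') ring_of_type_algebra"
      "M' |\<in>| node_children M \<Longrightarrow> primeideal (node_ideal M') ring_of_type_algebra" for N' M'
    using pT pT' vN vM unfolding is_ptree_def by blast+
  note closures = closure_C_node[OF pT vN] closure_C_node[OF pT' vM]
  \<comment> \<open>The equal unions match the children by their ideals; the induction hypothesis,
    one level deeper, then makes the matched subtrees equal.\<close>
  have "Ns = node_children M"
  proof (rule fset_eqI, rule iffI)
    fix N' assume N': "N' |\<in>| Ns"
    obtain M' where "M' |\<in>| node_children M" "node_ideal M' = node_ideal N'"
      using sibling_ideals_determined[OF primes(1) closures(1) irr(1) primes(2) closures(2) eq N'] by blast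
    then show "N' |\<in>| node_children M" using PNode.IH[OF N' vN[OF N'] vM] by metis
  next
    fix M' assume M': "M' |\<in>| node_children M"
    obtain N' where "N' |\<in>| Ns" "node_ideal N' = node_ideal M'"
      using sibling_ideals_determined[OF primes(2) closures(2) irr(2) primes(1) closures(1) eq[symmetric] M'] by blast
    then show "M' |\<in>| Ns" using PNode.IH[OF _ vN vM[OF M']] by metis
  qed
  then show ?case using PNode.prems(3) by (cases M) simp
qed

text \<open>The union over the children of the root is \<open>S\<close> itself, which fixes the
  ideals at level 1; \<open>gcs_node_unique\<close> fixes everything below.\<close>

lemma gcs_unique:
  assumes T: "is_gcs \<iota> T S" and T': "is_gcs \<iota> T' S"
  shows "T = T'"
proof -
  have sub: "root_children T |\<subseteq>| root_children T'"
    if T: "is_gcs \<iota> T S" and T': "is_gcs \<iota> T' S" for T T'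
  proof
    fix N assume N: "N |\<in>| root_children T"
    have pT: "is_ptree T" and pT': "is_ptree T'" using T T' by (auto simp: is_gcs_def)
    have irr: "irredundant (root_children T)" using pT by (simp add: is_ptree_def)
    have v: "N |\<in>| root_children T \<Longrightarrow> vertex_at T 1 N" "M |\<in>| root_children T' \<Longrightarrow> vertex_at T' 1 M" for N M
      by (rule vertex_at.intros(1), assumption)+
    have primes: "N |\<in>| root_children T \<Longrightarrow> primeideal (node_ideal N) ring_of_type_algebra"
      "M |\<in>| root_children T' \<Longrightarrow> primeideal (node_ideal M) ring_of_type_algebra" for N M
      using pT pT' v unfolding is_ptree_def by blast+
    have eq: "(\<Union>N\<in>fset (root_children T). C_node \<iota> N) = (\<Union>M\<in>fset (root_children T'). C_node \<iota> M)"
      using T T' by (simp add: is_gcs_def C_root_def)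
    obtain M where M: "M |\<in>| root_children T'" "node_ideal M = node_ideal N"
      using sibling_ideals_determined[OF primes(1) closure_C_node[OF pT v(1)] irr
          primes(2) closure_C_node[OF pT' v(2)] eq N] by blast
    then have "N = M" using gcs_node_unique[OF T T' v(1)[OF N] v(2)[OF M(1)]] by simp
    then show "N |\<in>| root_children T'" using M(1) by simp
  qed
  have "root_children T = root_children T'" using sub[OF T T'] sub[OF T' T] by (rule fsubset_antisym)
  then show ?thesis by (simp add: ptree.expand)
qed

end

theorem theorem7:
  fixes \<iota> :: "'k::field \<Rightarrow> 'l::alg_closed_field"
    and S :: "('n::finite \<Rightarrow> 'l) set"
    and T :: "('k, 'n) mpoly ptree"
  assumes "\<iota> \<in> ring_hom ring_of_type_algebra ring_of_type_algebra"
    and "is_gcs \<iota> T S"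
  shows "(\<forall>j N. vertex_at T j N \<longrightarrow>
            zariski_closure (C_node \<iota> N) = zero_set \<iota> (node_ideal N)) \<and>
         (zariski_closure S = zariski_closure (C_root \<iota> T) \<and>
          zariski_closure (C_root \<iota> T) =
            (\<Union>N\<in>fset (root_children T). zero_set \<iota> (node_ideal N))) \<and>
         (\<exists>!T' :: ('k, 'n) mpoly ptree. is_gcs \<iota> T' S)"
proof -
  interpret alg_closed_extension \<iota>
    using assms(1) by unfold_locales (auto simp: ring_hom_def ring_of_type_algebra_def Pi_def)
  have T: "is_ptree T" "S = C_root \<iota> T" using assms(2) by (auto simp: is_gcs_def)
  note closure = closure_C_node[OF T(1)]
  have "zariski_closure (C_root \<iota> T) = (\<Union>N\<in>fset (root_children T). zero_set \<iota> (node_ideal N))"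
    unfolding C_root_def
    by (rule zariski_closure_UN)
      (simp_all add: closure[OF vertex_at.intros(1)] zariski_closed_zero_set[OF comm_ring_map_axioms])
  then show ?thesis using closure T(2) assms(2) gcs_unique by blast
qed

end
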